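(* Let $G$ be a solvable group of derived length $d$. (i) If $\exp(G)$ is odd, then $\exp(G\otimes G)\mid (\exp(G))^{d}$. In particular, $\exp(M(G))\mid (\exp(G))^{d}$. (ii) If $\exp(G)$ is even, then $\exp(G\otimes G)\mid 2^{d-1}(\exp(G))^{d}$. In particular, $\exp(M(G))\mid 2^{d-1}(\exp(G))^{d}$.
   Context: $\exp(X)$ denotes the exponent of a group $X$ (a positive integer; saying it is odd or even presupposes it is finite). Write ${}^g h=ghg^{-1}$. The nonabelian tensor square $G\otimes G$ is the group generated by symbols $g\otimes h$ ($g,h\in G$) subject to the relations $gg'\otimes h=({}^g g'\otimes {}^g h)(g\otimes h)$ and $g\otimes hh'=(g\otimes h)({}^h g\otimes {}^h h')$ for all $g,g',h,h'\in G$. The (nonabelian) exterior square is $G\wedge G=(G\otimes G)/\nabla(G)$, where $\nabla(G)$ is the subgroup generated by all $x\otimes x$, $x\in G$. The Schur multiplier is $M(G)=H_2(G,\mathbb{Z})$; it is isomorphic to the kernel of the homomorphism $G\wedge G\to [G,G]$, $g\wedge h\mapsto [g,h]=ghg^{-1}h^{-1}$. *)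

theory Defs
  imports "HOL-Algebra.Algebra"
begin

text \<open>The value 0 stands for an infinite exponent; so \<open>group_exponent G dvd n\<close> with
  \<open>n > 0\<close> entails that the exponent of \<open>G\<close> is finite.\<close>

definition group_exponent :: "('a, 'b) monoid_scheme \<Rightarrow> nat" where
  "group_exponent G =
     (if \<exists>n>0. \<forall>x\<in>carrier G. x [^]\<^bsub>G\<^esub> (n::nat) = \<one>\<^bsub>G\<^esub>
      then LEAST n. n > 0 \<and> (\<forall>x\<in>carrier G. x [^]\<^bsub>G\<^esub> n = \<one>\<^bsub>G\<^esub>) else 0)"

text \<open>Only meaningful if \<open>G\<close> is solvable. The trivial group has length 0.\<close>

definition derived_length :: "('a, 'b) monoid_scheme \<Rightarrow> nat" where
  "derived_length G = (LEAST n. (derived G ^^ n) (carrier G) = {\<one>\<^bsub>G\<^esub>})"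

text \<open>A letter \<open>(True, x)\<close> stands for the generator \<open>x\<close>, and \<open>(False, x)\<close> for its formal
  inverse. The relations are pairs of words (left hand side, right hand side).\<close>

type_synonym 'x word = "(bool \<times> 'x) list"

definition words :: "'x set \<Rightarrow> 'x word set" where
  "words S = lists (UNIV \<times> S)"

inductive_set pres_cong :: "'x set \<Rightarrow> ('x word \<times> 'x word) set \<Rightarrow> ('x word \<times> 'x word) set"
  for S :: "'x set" and R :: "('x word \<times> 'x word) set" where
  refl: "w \<in> words S \<Longrightarrow> (w, w) \<in> pres_cong S R"
| sym: "(u, v) \<in> pres_cong S R \<Longrightarrow> (v, u) \<in> pres_cong S R"
| trans: "(u, v) \<in> pres_cong S R \<Longrightarrow> (v, w) \<in> pres_cong S R \<Longrightarrow> (u, w) \<in> pres_cong S R"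
| append: "(u, v) \<in> pres_cong S R \<Longrightarrow> (u', v') \<in> pres_cong S R \<Longrightarrow>
    (u @ u', v @ v') \<in> pres_cong S R"
| cancel: "x \<in> S \<Longrightarrow> ([(b, x), (\<not> b, x)], []) \<in> pres_cong S R"
| relation: "(u, v) \<in> R \<Longrightarrow> u \<in> words S \<Longrightarrow> v \<in> words S \<Longrightarrow> (u, v) \<in> pres_cong S R"

definition presented_group :: "'x set \<Rightarrow> ('x word \<times> 'x word) set \<Rightarrow> 'x word set monoid" where
  "presented_group S R =
     \<lparr>carrier = words S // pres_cong S R,
      monoid.mult = (\<lambda>A B. \<Union>u\<in>A. \<Union>v\<in>B. pres_cong S R `` {u @ v}),
      one = pres_cong S R `` {[]}\<rparr>"

lemma pres_cong_words:
  "(u, v) \<in> pres_cong S R \<Longrightarrow> u \<in> words S \<and> v \<in> words S"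
  by (induction rule: pres_cong.induct) (auto simp: words_def)

lemma equiv_pres_cong: "equiv (words S) (pres_cong S R)"
  by (rule equivI)
    (auto simp: refl_on_def dest: pres_cong_words
      intro: pres_cong.refl pres_cong.sym pres_cong.trans intro!: symI transI)

lemma mult_presented_group:
  assumes "u \<in> words S" "v \<in> words S"
  shows "pres_cong S R `` {u} \<otimes>\<^bsub>presented_group S R\<^esub> pres_cong S R `` {v}
           = pres_cong S R `` {u @ v}"
proof -
  have "congruent2 (pres_cong S R) (pres_cong S R) (\<lambda>u v. pres_cong S R `` {u @ v})"
    by (rule congruent2I'[OF equiv_class_eq[OF equiv_pres_cong]]) (rule pres_cong.append)
  from UN_equiv_class2[OF equiv_pres_cong equiv_pres_cong this assms]
  show ?thesis by (simp add: presented_group_def)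
qed

lemma carrier_presented_groupE:
  assumes "A \<in> carrier (presented_group S R)"
  obtains u where "u \<in> words S" "A = pres_cong S R `` {u}"
  using assms by (auto simp: presented_group_def elim: quotientE)

lemma class_in_presented_group:
  "u \<in> words S \<Longrightarrow> pres_cong S R `` {u} \<in> carrier (presented_group S R)"
  by (simp add: presented_group_def quotientI)

lemma one_presented_group: "\<one>\<^bsub>presented_group S R\<^esub> = pres_cong S R `` {[]}"
  by (simp add: presented_group_def)

lemma append_in_words: "u \<in> words S \<Longrightarrow> v \<in> words S \<Longrightarrow> u @ v \<in> words S"
  by (simp add: words_def)

lemma Nil_in_words: "[] \<in> words S"
  by (simp add: words_def)

lemma ex_left_inverse_word:
  "u \<in> words S \<Longrightarrow> \<exists>v\<in>words S. (v @ u, []) \<in> pres_cong S R"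
proof (induction u)
  case Nil
  have "([] @ [], []) \<in> pres_cong S R" by (simp add: pres_cong.refl Nil_in_words)
  then show ?case using Nil_in_words by blast
next
  case (Cons a u)
  obtain b x where a: "a = (b, x)" and x: "x \<in> S"
    using Cons.prems by (auto simp: words_def)
  have u: "u \<in> words S" using Cons.prems by (simp add: words_def)
  then obtain v where v: "v \<in> words S" "(v @ u, []) \<in> pres_cong S R"
    using Cons.IH by blast
  have "([(\<not> b, x), (b, x)] @ u, [] @ u) \<in> pres_cong S R"
    using pres_cong.append[OF pres_cong.cancel[OF x, of "\<not> b"] pres_cong.refl[OF u]] by simp
  from pres_cong.append[OF pres_cong.refl[OF v(1)] this]
  have "((v @ [(\<not> b, x)]) @ a # u, v @ u) \<in> pres_cong S R" by (simp add: a)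
  then have "((v @ [(\<not> b, x)]) @ a # u, []) \<in> pres_cong S R"
    using v(2) by (rule pres_cong.trans)
  moreover have "v @ [(\<not> b, x)] \<in> words S" using v(1) x by (simp add: words_def)
  ultimately show ?case by blast
qed

lemma group_presented_group: "group (presented_group S R)"
proof (rule groupI)
  fix A B C
  assume A: "A \<in> carrier (presented_group S R)" and B: "B \<in> carrier (presented_group S R)"
  obtain u where u: "u \<in> words S" "A = pres_cong S R `` {u}"
    using A by (rule carrier_presented_groupE)
  obtain v where v: "v \<in> words S" "B = pres_cong S R `` {v}"
    using B by (rule carrier_presented_groupE)
  show "A \<otimes>\<^bsub>presented_group S R\<^esub> B \<in> carrier (presented_group S R)"
    using u v by (simp add: mult_presented_group append_in_words class_in_presented_group)
  assume C: "C \<in> carrier (presented_group S R)"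
  obtain w where w: "w \<in> words S" "C = pres_cong S R `` {w}"
    using C by (rule carrier_presented_groupE)
  show "A \<otimes>\<^bsub>presented_group S R\<^esub> B \<otimes>\<^bsub>presented_group S R\<^esub> C
      = A \<otimes>\<^bsub>presented_group S R\<^esub> (B \<otimes>\<^bsub>presented_group S R\<^esub> C)"
    using u v w by (simp add: mult_presented_group append_in_words)
next
  show "\<one>\<^bsub>presented_group S R\<^esub> \<in> carrier (presented_group S R)"
    by (simp add: one_presented_group class_in_presented_group Nil_in_words)
next
  fix A assume A: "A \<in> carrier (presented_group S R)"
  obtain u where u: "u \<in> words S" "A = pres_cong S R `` {u}"
    using A by (rule carrier_presented_groupE)
  show "\<one>\<^bsub>presented_group S R\<^esub> \<otimes>\<^bsub>presented_group S R\<^esub> A = A"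
    using u by (simp add: one_presented_group mult_presented_group Nil_in_words)
  obtain v where v: "v \<in> words S" "(v @ u, []) \<in> pres_cong S R"
    using ex_left_inverse_word[OF u(1)] by blast
  have "pres_cong S R `` {v} \<otimes>\<^bsub>presented_group S R\<^esub> A = \<one>\<^bsub>presented_group S R\<^esub>"
    using u v equiv_class_eq[OF equiv_pres_cong v(2)]
    by (simp add: one_presented_group mult_presented_group)
  then show "\<exists>B\<in>carrier (presented_group S R).
      B \<otimes>\<^bsub>presented_group S R\<^esub> A = \<one>\<^bsub>presented_group S R\<^esub>"
    using class_in_presented_group[OF v(1)] by blast
qed

definition conj_by :: "('a, 'b) monoid_scheme \<Rightarrow> 'a \<Rightarrow> 'a \<Rightarrow> 'a" where
  "conj_by G g h = g \<otimes>\<^bsub>G\<^esub> h \<otimes>\<^bsub>G\<^esub> inv\<^bsub>G\<^esub> g"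

abbreviation tensor_symbol :: "'a \<Rightarrow> 'a \<Rightarrow> bool \<times> 'a \<times> 'a" where
  "tensor_symbol g h \<equiv> (True, g, h)"

definition tensor_relations :: "('a, 'b) monoid_scheme \<Rightarrow> (('a \<times> 'a) word \<times> ('a \<times> 'a) word) set"
  where
  "tensor_relations G =
     {([tensor_symbol (g \<otimes>\<^bsub>G\<^esub> g') h],
       [tensor_symbol (conj_by G g g') (conj_by G g h), tensor_symbol g h])
      | g g' h. g \<in> carrier G \<and> g' \<in> carrier G \<and> h \<in> carrier G}
   \<union> {([tensor_symbol g (h \<otimes>\<^bsub>G\<^esub> h')],
       [tensor_symbol g h, tensor_symbol (conj_by G h g) (conj_by G h h')])
      | g h h'. g \<in> carrier G \<and> h \<in> carrier G \<and> h' \<in> carrier G}"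

definition tensor_square :: "('a, 'b) monoid_scheme \<Rightarrow> ('a \<times> 'a) word set monoid" where
  "tensor_square G = presented_group (carrier G \<times> carrier G) (tensor_relations G)"

lemma group_tensor_square: "group (tensor_square G)"
  by (simp add: tensor_square_def group_presented_group)

text \<open>\<open>H\<^sub>2(G, \<int>)\<close> is computed from the unnormalised bar complex with trivial integer
  coefficients; its \<open>n\<close>-chains are the free abelian group on \<open>G\<^sup>n\<close>.\<close>

definition bar_boundary2 :: "('a, 'b) monoid_scheme \<Rightarrow> ('a \<times> 'a \<Rightarrow>\<^sub>0 int) \<Rightarrow> ('a \<Rightarrow>\<^sub>0 int)" where
  "bar_boundary2 G =
     frag_extend (\<lambda>(g, h). frag_of h - frag_of (g \<otimes>\<^bsub>G\<^esub> h) + frag_of g)"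

definition bar_boundary3 ::
  "('a, 'b) monoid_scheme \<Rightarrow> ('a \<times> 'a \<times> 'a \<Rightarrow>\<^sub>0 int) \<Rightarrow> ('a \<times> 'a \<Rightarrow>\<^sub>0 int)" where
  "bar_boundary3 G =
     frag_extend (\<lambda>(g, h, k). frag_of (h, k) - frag_of (g \<otimes>\<^bsub>G\<^esub> h, k)
                                + frag_of (g, h \<otimes>\<^bsub>G\<^esub> k) - frag_of (g, h))"

definition bar_cycles2 :: "('a, 'b) monoid_scheme \<Rightarrow> ('a \<times> 'a \<Rightarrow>\<^sub>0 int) set" where
  "bar_cycles2 G =
     kernel (free_Abelian_group (carrier G \<times> carrier G)) (free_Abelian_group (carrier G))
       (bar_boundary2 G)"

definition bar_boundaries2 :: "('a, 'b) monoid_scheme \<Rightarrow> ('a \<times> 'a \<Rightarrow>\<^sub>0 int) set" where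
  "bar_boundaries2 G =
     bar_boundary3 G ` carrier (free_Abelian_group (carrier G \<times> carrier G \<times> carrier G))"

definition schur_multiplier :: "('a, 'b) monoid_scheme \<Rightarrow> ('a \<times> 'a \<Rightarrow>\<^sub>0 int) set monoid" where
  "schur_multiplier G =
     (free_Abelian_group (carrier G \<times> carrier G)) \<lparr>carrier := bar_cycles2 G\<rparr> Mod bar_boundaries2 G"

lemma (in group) bar_boundary2_hom:
  "bar_boundary2 G \<in> hom (free_Abelian_group (carrier G \<times> carrier G))
                          (free_Abelian_group (carrier G))"
proof (rule homI)
  fix c assume "c \<in> carrier (free_Abelian_group (carrier G \<times> carrier G))"
  then have c: "Poly_Mapping.keys c \<subseteq> carrier G \<times> carrier G" by simp
  have keys: "Poly_Mapping.keys (frag_of h - frag_of (g \<otimes> h) + frag_of g) \<subseteq> carrier G"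
    if "g \<in> carrier G" "h \<in> carrier G" for g h
    using that keys_add[of "frag_of h - frag_of (g \<otimes> h)" "frag_of g"]
      keys_diff[of "frag_of h" "frag_of (g \<otimes> h)"] by auto
  then show "bar_boundary2 G c \<in> carrier (free_Abelian_group (carrier G))"
    unfolding bar_boundary2_def carrier_free_Abelian_group_iff
    using c by (intro order_trans[OF keys_frag_extend] UN_least) (auto dest!: subsetD[OF keys, rotated -1])
qed (simp add: bar_boundary2_def frag_extend_add)

lemma (in group) bar_boundary3_hom:
  "bar_boundary3 G \<in> hom (free_Abelian_group (carrier G \<times> carrier G \<times> carrier G))
                          (free_Abelian_group (carrier G \<times> carrier G))"
proof (rule homI)
  fix c assume "c \<in> carrier (free_Abelian_group (carrier G \<times> carrier G \<times> carrier G))"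
  then have c: "Poly_Mapping.keys c \<subseteq> carrier G \<times> carrier G \<times> carrier G" by simp
  let ?b = "\<lambda>g h k. frag_of (h, k) - frag_of (g \<otimes> h, k) + frag_of (g, h \<otimes> k) - frag_of (g, h)"
  have keys: "Poly_Mapping.keys (?b g h k) \<subseteq> carrier G \<times> carrier G"
    if "g \<in> carrier G" "h \<in> carrier G" "k \<in> carrier G" for g h k
    using that
      keys_diff[of "frag_of (h, k) - frag_of (g \<otimes> h, k) + frag_of (g, h \<otimes> k)" "frag_of (g, h)"]
      keys_add[of "frag_of (h, k) - frag_of (g \<otimes> h, k)" "frag_of (g, h \<otimes> k)"]
      keys_diff[of "frag_of (h, k)" "frag_of (g \<otimes> h, k)"] by auto
  then show "bar_boundary3 G c \<in> carrier (free_Abelian_group (carrier G \<times> carrier G))"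
    unfolding bar_boundary3_def carrier_free_Abelian_group_iff
    using c by (intro order_trans[OF keys_frag_extend] UN_least) (auto dest!: subsetD[OF keys, rotated -1])
qed (simp add: bar_boundary3_def frag_extend_add)

lemma (in group) bar_boundary2_boundary3:
  assumes "c \<in> carrier (free_Abelian_group (carrier G \<times> carrier G \<times> carrier G))"
  shows "bar_boundary2 G (bar_boundary3 G c) = 0"
proof -
  have "Poly_Mapping.keys c \<subseteq> carrier G \<times> carrier G \<times> carrier G" using assms by simp
  then show ?thesis
    by (induction c rule: frag_induction)
      (auto simp: bar_boundary2_def bar_boundary3_def frag_extend_add frag_extend_diff m_assoc)
qed

lemma (in group) comm_group_schur_multiplier: "comm_group (schur_multiplier G)"
proof -
  let ?F1 = "free_Abelian_group (carrier G)"
  let ?F2 = "free_Abelian_group (carrier G \<times> carrier G)"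
  let ?F3 = "free_Abelian_group (carrier G \<times> carrier G \<times> carrier G)"
  let ?Z = "?F2\<lparr>carrier := bar_cycles2 G\<rparr>"
  interpret d2: group_hom ?F2 ?F1 "bar_boundary2 G"
    by (simp add: group_hom_def group_hom_axioms_def bar_boundary2_hom)
  interpret d3: group_hom ?F3 ?F2 "bar_boundary3 G"
    by (simp add: group_hom_def group_hom_axioms_def bar_boundary3_hom)
  have Z: "subgroup (bar_cycles2 G) ?F2"
    unfolding bar_cycles2_def by (rule d2.subgroup_kernel)
  have B: "subgroup (bar_boundaries2 G) ?F2"
    unfolding bar_boundaries2_def by (rule d3.img_is_subgroup)
  have BZ: "bar_boundaries2 G \<subseteq> bar_cycles2 G"
  proof
    fix z assume "z \<in> bar_boundaries2 G"
    then obtain c where c: "c \<in> carrier ?F3" "z = bar_boundary3 G c"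
      unfolding bar_boundaries2_def by blast
    then show "z \<in> bar_cycles2 G"
      using d3.hom_closed[OF c(1)] bar_boundary2_boundary3[OF c(1)]
      by (simp add: bar_cycles2_def kernel_def)
  qed
  interpret Z: comm_group ?Z
    by (rule group.group_comm_groupI[OF group.subgroup_imp_group[OF group_free_Abelian_group Z]])
      (simp add: add.commute)
  have "subgroup (bar_boundaries2 G) ?Z"
    using group.subgroup_incl[OF group_free_Abelian_group B Z BZ] .
  then show ?thesis
    unfolding schur_multiplier_def by (rule Z.abelian_FactGroup)
qed

end

theory Submission
  imports Defs
begin

text \<open>
  Both \<open>g \<otimes> h\<close> and commutators of lifts to a central extension of \<open>G\<close> are crossed pairings
  \<open>T : G \<times> G \<rightarrow> H\<close>, i.e. they satisfy the tensor relations. For such a pairing, conjugation by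
  \<open>T g h\<close> is the action of \<open>[g, h]\<close> and \<open>[T g h, T x y] = T [g, h] [x, y]\<close>. For a term \<open>A\<close> of the
  derived series, let \<open>span A\<close> be generated by all \<open>T a g\<close> and \<open>T g a\<close> with \<open>a \<in> A\<close>. Modulo
  \<open>span [A, A]\<close>, the group \<open>span A\<close> has class at most 2: its commutators are values of \<open>T\<close> on
  \<open>A \<times> A\<close>, where \<open>T\<close> is bilinear and central. As \<open>T a\<^sup>m g = (T a [a, g])\<^sup>k (T a g)\<^sup>m\<close> with
  \<open>k = m choose 2\<close>, its exponent divides \<open>n = exp G\<close> for odd \<open>n\<close> and \<open>2n\<close> in general; for
  \<open>A = G\<close> it always divides \<open>n\<close>, since then the factors with exponent \<open>k\<close> vanish. Descending the
  derived series gives the bound for every \<open>H\<close> generated by the values of \<open>T\<close>.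

  For the Schur multiplier, the chains modulo boundaries carry a universal 2-cocycle, and the 2-cycles
  lie in the commutator subgroup of the corresponding central extension.
\<close>

section \<open>Commutators and groups of class two\<close>

definition commutator :: "('a, 'b) monoid_scheme \<Rightarrow> 'a \<Rightarrow> 'a \<Rightarrow> 'a" where
  "commutator G x y = x \<otimes>\<^bsub>G\<^esub> y \<otimes>\<^bsub>G\<^esub> inv\<^bsub>G\<^esub> x \<otimes>\<^bsub>G\<^esub> inv\<^bsub>G\<^esub> y"

context group
begin

lemma inv_mult_cancel [simp]:
  "x \<in> carrier G \<Longrightarrow> y \<in> carrier G \<Longrightarrow> inv x \<otimes> (x \<otimes> y) = y"
  "x \<in> carrier G \<Longrightarrow> y \<in> carrier G \<Longrightarrow> x \<otimes> (inv x \<otimes> y) = y"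
  by (simp_all add: m_assoc [symmetric])

lemma conj_by_closed [simp]:
  "g \<in> carrier G \<Longrightarrow> x \<in> carrier G \<Longrightarrow> conj_by G g x \<in> carrier G"
  by (simp add: conj_by_def)

lemma commutator_closed [simp]:
  "x \<in> carrier G \<Longrightarrow> y \<in> carrier G \<Longrightarrow> commutator G x y \<in> carrier G"
  by (simp add: commutator_def)

lemmas word_simps = conj_by_def commutator_def m_assoc inv_mult_group

lemma conj_by_one [simp]: "x \<in> carrier G \<Longrightarrow> conj_by G \<one> x = x"
  by (simp add: word_simps)

lemma conj_by_mult:
  "\<lbrakk>g \<in> carrier G; x \<in> carrier G; y \<in> carrier G\<rbrakk>
    \<Longrightarrow> conj_by G g (x \<otimes> y) = conj_by G g x \<otimes> conj_by G g y"
  by (simp add: word_simps)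

lemma conj_by_inv:
  "\<lbrakk>g \<in> carrier G; x \<in> carrier G\<rbrakk> \<Longrightarrow> conj_by G g (inv x) = inv (conj_by G g x)"
  by (simp add: word_simps)

lemma conj_by_conj_by:
  "\<lbrakk>g \<in> carrier G; h \<in> carrier G; x \<in> carrier G\<rbrakk>
    \<Longrightarrow> conj_by G g (conj_by G h x) = conj_by G (g \<otimes> h) x"
  by (simp add: word_simps)

lemma inv_commutator:
  "\<lbrakk>x \<in> carrier G; y \<in> carrier G\<rbrakk> \<Longrightarrow> inv (commutator G x y) = commutator G y x"
  by (simp add: word_simps)

lemma commutator_eq_one_iff:
  assumes "x \<in> carrier G" "y \<in> carrier G"
  shows "commutator G x y = \<one> \<longleftrightarrow> x \<otimes> y = y \<otimes> x"
proof -
  have "commutator G x y \<otimes> (y \<otimes> x) = x \<otimes> y" using assms by (simp add: word_simps)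
  then show ?thesis using assms
    by (metis commutator_closed l_one m_closed r_cancel_one')
qed

lemma mult_eq_commutator_mult:
  "\<lbrakk>x \<in> carrier G; y \<in> carrier G\<rbrakk> \<Longrightarrow> x \<otimes> y = commutator G x y \<otimes> (y \<otimes> x)"
  by (simp add: word_simps)

lemma commutator_mult_right:
  "\<lbrakk>x \<in> carrier G; y \<in> carrier G; z \<in> carrier G\<rbrakk>
    \<Longrightarrow> commutator G x (y \<otimes> z) = commutator G x y \<otimes> conj_by G y (commutator G x z)"
  by (simp add: word_simps)

lemma commutator_mult_left:
  "\<lbrakk>x \<in> carrier G; y \<in> carrier G; z \<in> carrier G\<rbrakk>
    \<Longrightarrow> commutator G (x \<otimes> y) z = conj_by G x (commutator G y z) \<otimes> commutator G x z"
  by (simp add: word_simps)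

lemma conj_by_commutator:
  "\<lbrakk>g \<in> carrier G; x \<in> carrier G; y \<in> carrier G\<rbrakk>
    \<Longrightarrow> conj_by G g (commutator G x y) = commutator G (conj_by G g x) (conj_by G g y)"
  by (simp add: word_simps)

lemma derived_eq_generate_commutators:
  "derived G S = generate G {commutator G x y | x y. x \<in> S \<and> y \<in> S}"
  unfolding derived_def commutator_def by (rule arg_cong[of _ _ "generate G"]) blast

text \<open>Collecting the \<open>x\<close> on the left moves the \<open>i\<close>-th of them,
  counted from 0, past \<open>i\<close> factors \<open>y\<close>, at the price of one commutator
  each. These commute with \<open>x\<close> and \<open>y\<close>, and
  \<open>0 + 1 + ... + (k - 1) = k choose 2\<close>.\<close>

lemma pow_mult_central_commutator:
  assumes x: "x \<in> carrier G" and y: "y \<in> carrier G"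
    and zx: "commutator G y x \<otimes> x = x \<otimes> commutator G y x"
    and zy: "commutator G y x \<otimes> y = y \<otimes> commutator G y x"
  shows "(x \<otimes> y) [^] k = commutator G y x [^] (k choose 2) \<otimes> (x [^] k \<otimes> y [^] (k::nat))"
proof -
  let ?z = "commutator G y x"
  have z: "?z \<in> carrier G" using x y by simp
  have zkx: "?z [^] i \<otimes> x = x \<otimes> ?z [^] i" for i :: nat
    using x z zx by (induction i) (simp_all add: m_assoc, metis m_assoc nat_pow_closed)
  have zky: "?z [^] i \<otimes> y = y \<otimes> ?z [^] i" for i :: nat
    using y z zy by (induction i) (simp_all add: m_assoc, metis m_assoc nat_pow_closed)
  have zkxj: "?z [^] i \<otimes> x [^] j = x [^] j \<otimes> ?z [^] i" for i j :: nat
    using x z zkx[of i] by (induction j) (simp_all add: m_assoc, metis m_assoc nat_pow_closed)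
  have yx: "y [^] i \<otimes> x = ?z [^] i \<otimes> (x \<otimes> y [^] i)" for i :: nat
  proof (induction i)
    case 0 then show ?case using x by simp
  next
    case (Suc i)
    have "y [^] Suc i \<otimes> x = y [^] i \<otimes> (y \<otimes> x)" using x y by (simp add: m_assoc)
    also have "\<dots> = y [^] i \<otimes> (?z \<otimes> (x \<otimes> y))"
      using mult_eq_commutator_mult[OF y x] by simp
    also have "\<dots> = (y [^] i \<otimes> x) \<otimes> (?z \<otimes> y)"
      using x y z zx by (simp add: m_assoc [symmetric])
    also have "\<dots> = ?z [^] i \<otimes> (x \<otimes> ((y [^] i \<otimes> ?z) \<otimes> y))"
      using x y z by (simp add: Suc m_assoc)
    also have "y [^] i \<otimes> ?z = ?z \<otimes> y [^] i"
      using y z zy by (induction i) (simp_all add: m_assoc, metis m_assoc nat_pow_closed)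
    also have "?z [^] i \<otimes> (x \<otimes> ((?z \<otimes> y [^] i) \<otimes> y)) = ?z [^] i \<otimes> ((x \<otimes> ?z) \<otimes> y [^] Suc i)"
      using x y z by (simp add: m_assoc)
    also have "\<dots> = ?z [^] Suc i \<otimes> (x \<otimes> y [^] Suc i)"
      unfolding zx[symmetric] using x y z by (simp add: m_assoc)
    finally show ?case .
  qed
  show ?thesis
  proof (induction k)
    case 0 then show ?case using x y by (simp add: numeral_2_eq_2)
  next
    case (Suc k)
    have "(x \<otimes> y) [^] Suc k
        = ?z [^] (k choose 2) \<otimes> (x [^] k \<otimes> ((y [^] k \<otimes> x) \<otimes> y))"
      using x y z Suc by (simp add: m_assoc)
    also have "\<dots> = ?z [^] (k choose 2) \<otimes> ((x [^] k \<otimes> ?z [^] k) \<otimes> (x \<otimes> y [^] Suc k))"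
      using x y z by (simp add: yx m_assoc)
    also have "\<dots> = (?z [^] (k choose 2) \<otimes> ?z [^] k) \<otimes> (x [^] Suc k \<otimes> y [^] Suc k)"
      unfolding zkxj[symmetric] using x y z by (simp add: m_assoc)
    also have "?z [^] (k choose 2) \<otimes> ?z [^] k = ?z [^] (Suc k choose 2)"
      using z by (simp add: nat_pow_mult numeral_2_eq_2 add.commute)
    finally show ?case .
  qed
qed

text \<open>The hypotheses concern generators only, but they force class at most two: all
  commutators of the generated subgroup are central in it and killed by \<open>m choose 2\<close>.
  The collection formula then makes the \<open>m\<close>-th power multiplicative.\<close>

lemma generate_pow_eq_one:
  assumes S: "S \<subseteq> carrier G"
    and central: "\<And>s t u. \<lbrakk>s \<in> S; t \<in> S; u \<in> S\<rbrakk>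
      \<Longrightarrow> commutator G s t \<otimes> u = u \<otimes> commutator G s t"
    and torsion: "\<And>s t. \<lbrakk>s \<in> S; t \<in> S\<rbrakk> \<Longrightarrow> commutator G s t [^] (m choose 2) = \<one>"
    and pow: "\<And>s. s \<in> S \<Longrightarrow> s [^] (m::nat) = \<one>"
    and x: "x \<in> generate G S"
  shows "x [^] m = \<one>"
proof -
  let ?K = "generate G S"
  \<comment> \<open>\<open>D\<close> holds the central elements of \<open>?K\<close> with the
    desired torsion. It is a subgroup, so membership of commutators in \<open>D\<close> can spread
    from the generators to all of \<open>?K\<close>.\<close>
  define D where "D = {z \<in> ?K. (\<forall>y\<in>?K. z \<otimes> y = y \<otimes> z) \<and> z [^] (m choose 2) = \<one>}"
  have K: "y \<in> carrier G" if "y \<in> ?K" for y using generate_in_carrier[OF S that] .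
  interpret K: subgroup ?K G by (rule generate_is_subgroup[OF S])
  have commute: "z \<otimes> y = y \<otimes> z"
    if z: "z \<in> carrier G" and "\<And>u. u \<in> S \<Longrightarrow> z \<otimes> u = u \<otimes> z" and y: "y \<in> ?K" for z y
    using y
  proof induction
    case one then show ?case using z by simp
  next
    case (incl h) then show ?case using that by simp
  next
    case (inv h)
    then have "z \<otimes> h = h \<otimes> z" "h \<in> carrier G" using that S by auto
    then show ?case using z
      by (metis inv_closed inv_solve_left inv_solve_right m_assoc m_closed)
  next
    case (eng h1 h2)
    then show ?case using z K by (metis m_assoc)
  qed
  have D_one: "\<one> \<in> D" using K by (simp add: D_def)
  have D_inv: "inv z \<in> D" if "z \<in> D" for z
  proof -
    have z: "z \<in> ?K" "\<And>y. y \<in> ?K \<Longrightarrow> z \<otimes> y = y \<otimes> z" "z [^] (m choose 2) = \<one>"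
      using that by (auto simp: D_def)
    have "inv z \<otimes> y = y \<otimes> inv z" if "y \<in> ?K" for y
      using z(1) z(2)[OF that] K that by (metis inv_closed inv_solve_left inv_solve_right m_assoc m_closed)
    then show ?thesis using z K by (simp add: D_def nat_pow_inv)
  qed
  have D_mult: "z \<otimes> w \<in> D" if "z \<in> D" "w \<in> D" for z w
  proof -
    have zw: "z \<in> carrier G" "w \<in> carrier G" "z \<in> ?K" "w \<in> ?K"
        "z [^] (m choose 2) = \<one>" "w [^] (m choose 2) = \<one>"
      and comm: "\<And>y. y \<in> ?K \<Longrightarrow> z \<otimes> y = y \<otimes> z" "\<And>y. y \<in> ?K \<Longrightarrow> w \<otimes> y = y \<otimes> w"
      using that K unfolding D_def by blast+
    have "z \<otimes> w \<otimes> y = y \<otimes> (z \<otimes> w)" if "y \<in> ?K" for y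
      using zw(1,2) K[OF that] comm[OF that] by (metis m_assoc)
    moreover have "(z \<otimes> w) [^] (m choose 2) = \<one>"
      using pow_mult_distrib[OF comm(1)[OF zw(4)] zw(1,2)] zw(5,6) by simp
    ultimately show ?thesis using zw by (simp add: D_def)
  qed
  have D_conj: "conj_by G y z = z" if "z \<in> D" "y \<in> ?K" for y z
  proof -
    have "y \<otimes> z = z \<otimes> y" and "z \<in> carrier G" "y \<in> carrier G"
      using that K unfolding D_def by auto
    then show ?thesis by (simp add: conj_by_def m_assoc)
  qed
  \<comment> \<open>Expanding the second argument yields conjugates of elements of \<open>D\<close>,
    and these conjugations are trivial. The rule is used twice, with an inversion in between that
    exchanges the arguments.\<close>
  have extend: "commutator G u y \<in> D"
    if u: "u \<in> ?K" and us: "\<And>s. s \<in> S \<Longrightarrow> commutator G u s \<in> D" and y: "y \<in> ?K" for u y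
    using y
  proof induction
    case one then show ?case using u K D_one by (simp add: commutator_def)
  next
    case (incl h) then show ?case by (rule us)
  next
    case (inv h)
    then have h: "h \<in> carrier G" "h \<in> ?K" using S by (auto intro: generate.incl)
    have "commutator G u (inv h) = conj_by G (inv h) (inv (commutator G u h))"
      using h K[OF u] by (simp add: word_simps)
    also have "\<dots> = inv (commutator G u h)"
      using D_conj[OF D_inv[OF us[OF inv]]] h by simp
    finally show ?case using D_inv[OF us[OF inv]] by simp
  next
    case (eng h1 h2)
    then show ?case using u K by (simp add: commutator_mult_right D_conj D_mult)
  qed
  have SS: "commutator G s t \<in> D" if "s \<in> S" "t \<in> S" for s t
  proof -
    have "commutator G s t \<in> ?K"
      unfolding commutator_def using that by (blast intro: generate.intros K.m_closed K.m_inv_closed)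
    then show ?thesis
      unfolding D_def using that S torsion
      by (blast intro: commute central commutator_closed)
  qed
  have SK: "commutator G s y \<in> D" if "s \<in> S" "y \<in> ?K" for s y
    using extend[OF generate.incl[OF that(1)] SS[OF that(1)] that(2)] .
  have KK: "commutator G y y' \<in> D" if "y \<in> ?K" "y' \<in> ?K" for y y'
  proof (rule extend[OF that(1) _ that(2)])
    fix s assume s: "s \<in> S"
    have "inv (commutator G s y) = commutator G y s"
      using s S K[OF that(1)] by (intro inv_commutator) auto
    then show "commutator G y s \<in> D" using D_inv[OF SK[OF s that(1)]] by simp
  qed
  show ?thesis using x
  proof induction
    case (inv h) then show ?case using pow[OF inv] S by (simp add: nat_pow_inv subset_iff)
  next
    case (eng x y)
    then have "commutator G y x \<in> D" by (simp add: KK)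
    then have "(x \<otimes> y) [^] m = commutator G y x [^] (m choose 2) \<otimes> (x [^] m \<otimes> y [^] m)"
      using eng unfolding D_def by (intro pow_mult_central_commutator) (blast intro: K)+
    moreover have "commutator G y x [^] (m choose 2) = \<one>"
      using \<open>commutator G y x \<in> D\<close> unfolding D_def by blast
    ultimately show ?case using eng by simp
  qed (auto simp: pow)
qed

end

section \<open>Crossed pairings\<close>

text \<open>The target is arbitrary because the descent passes to quotients of \<open>H\<close>, and
  because the Schur multiplier needs commutators in a central extension instead of the tensor
  square.\<close>

locale crossed_pairing = G: group G + H: group H
  for G (structure) and H (structure) +
  fixes T
  assumes T_closed [simp]: "\<lbrakk>g \<in> carrier G; h \<in> carrier G\<rbrakk> \<Longrightarrow> T g h \<in> carrier H"
    and T_mult_left: "\<lbrakk>g \<in> carrier G; g' \<in> carrier G; h \<in> carrier G\<rbrakk>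
      \<Longrightarrow> T (g \<otimes> g') h = T (conj_by G g g') (conj_by G g h) \<otimes>\<^bsub>H\<^esub> T g h"
    and T_mult_right: "\<lbrakk>g \<in> carrier G; h \<in> carrier G; h' \<in> carrier G\<rbrakk>
      \<Longrightarrow> T g (h \<otimes> h') = T g h \<otimes>\<^bsub>H\<^esub> T (conj_by G h g) (conj_by G h h')"
begin

lemma T_one_left [simp]: "h \<in> carrier G \<Longrightarrow> T \<one> h = \<one>\<^bsub>H\<^esub>"
  using T_mult_left[of \<one> \<one> h] by simp

lemma T_one_right [simp]: "g \<in> carrier G \<Longrightarrow> T g \<one> = \<one>\<^bsub>H\<^esub>"
  using T_mult_right[of g \<one> \<one>] by simp

lemma T_inv_left:
  assumes [simp]: "g \<in> carrier G" "h \<in> carrier G"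
  shows "T (inv g) (conj_by G g h) = inv\<^bsub>H\<^esub> T g h"
proof -
  have "T (conj_by G g (inv g)) (conj_by G g h) \<otimes>\<^bsub>H\<^esub> T g h = \<one>\<^bsub>H\<^esub>"
    using T_mult_left[of g "inv g" h] by simp
  moreover have "conj_by G g (inv g) = inv g" by (simp add: conj_by_def)
  ultimately show ?thesis by (simp add: H.inv_equality)
qed

text \<open>Swapping the arguments and inverting the value exchanges the two relations, so results
  about the left argument transfer to the right one.\<close>

lemma dual: "crossed_pairing G H (\<lambda>g h. inv\<^bsub>H\<^esub> T h g)"
  by unfold_locales (simp_all add: T_mult_left T_mult_right H.inv_mult_group)

text \<open>Both sides arise by expanding \<^term>\<open>T (g \<otimes> x) (h \<otimes> y)\<close>, starting with either argument.\<close>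

lemma T_interchange:
  assumes [simp]: "g \<in> carrier G" "h \<in> carrier G" "x \<in> carrier G" "y \<in> carrier G"
  shows "T g h \<otimes>\<^bsub>H\<^esub> T (conj_by G (h \<otimes> g) x) (conj_by G (h \<otimes> g) y)
       = T (conj_by G (g \<otimes> h) x) (conj_by G (g \<otimes> h) y) \<otimes>\<^bsub>H\<^esub> T g h"
proof -
  let ?c = "conj_by G"
  let ?a = "T (?c g x) (?c g h)" and ?b = "T (?c h g) (?c h y)"
  have hg: "?c (?c h g) (?c h z) = ?c (h \<otimes> g) z" "?c (?c g h) (?c g z) = ?c (g \<otimes> h) z"
    if "z \<in> carrier G" for z using that by (simp_all add: G.word_simps)
  have "T (g \<otimes> x) (h \<otimes> y)
      = ?a \<otimes>\<^bsub>H\<^esub> ((T g h \<otimes>\<^bsub>H\<^esub> T (?c (h \<otimes> g) x) (?c (h \<otimes> g) y)) \<otimes>\<^bsub>H\<^esub> ?b)"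
    by (simp add: T_mult_right[of "g \<otimes> x"] T_mult_left[of g x h] G.conj_by_mult
        T_mult_left[of "?c h g"] hg H.m_assoc)
  moreover have "T (g \<otimes> x) (h \<otimes> y)
      = ?a \<otimes>\<^bsub>H\<^esub> ((T (?c (g \<otimes> h) x) (?c (g \<otimes> h) y) \<otimes>\<^bsub>H\<^esub> T g h) \<otimes>\<^bsub>H\<^esub> ?b)"
    by (simp add: T_mult_left[of g x "h \<otimes> y"] G.conj_by_mult T_mult_right[of g h y]
        T_mult_right[of "?c g x"] hg H.m_assoc)
  ultimately show ?thesis by simp
qed

text \<open>This is \<open>T_interchange\<close> with \<open>x\<close> and \<open>y\<close> first
  conjugated by the inverse of \<open>h \<otimes> g\<close>; what remains is the action of
  \<open>(g \<otimes> h) \<otimes> inv (h \<otimes> g)\<close>, which is the commutator.\<close>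

lemma conj_by_T:
  assumes [simp]: "g \<in> carrier G" "h \<in> carrier G" "x \<in> carrier G" "y \<in> carrier G"
  shows "conj_by H (T g h) (T x y)
       = T (conj_by G (commutator G g h) x) (conj_by G (commutator G g h) y)"
proof -
  let ?i = "inv (h \<otimes> g)"
  have eq: "conj_by G (h \<otimes> g) (conj_by G ?i z) = z"
     "conj_by G (g \<otimes> h) (conj_by G ?i z) = conj_by G (commutator G g h) z"
    if "z \<in> carrier G" for z using that by (simp_all add: G.word_simps)
  show ?thesis
    using T_interchange[of g h "conj_by G ?i x" "conj_by G ?i y"]
    by (simp add: eq conj_by_def[of H] H.inv_solve_right')
qed

text \<open>Write the commutator as \<open>g\<close> times the conjugate of \<open>inv g\<close> by
  \<open>h\<close> and apply \<open>T_mult_left\<close>. The factor at the conjugate is evaluated by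
  \<open>expand\<close>, and all occurrences of \<open>T g k\<close> cancel.\<close>

lemma T_commutator_left:
  assumes [simp]: "g \<in> carrier G" "h \<in> carrier G" "k \<in> carrier G"
  shows "T (commutator G g h) k = T g h \<otimes>\<^bsub>H\<^esub> inv\<^bsub>H\<^esub> T (conj_by G k g) (conj_by G k h)"
proof -
  let ?c = "conj_by G" and ?g = "inv g"
  \<comment> \<open>The product \<open>k' \<otimes> h'\<close> is also \<open>h'\<close> times a
    conjugate of \<open>k'\<close>; comparing the two expansions of
    \<open>T g' (k' \<otimes> h')\<close> isolates the value at a conjugated first argument.\<close>
  have expand: "T (?c h' g') k' = inv\<^bsub>H\<^esub> T g' h' \<otimes>\<^bsub>H\<^esub> (T g' k' \<otimes>\<^bsub>H\<^esub> T (?c k' g') (?c k' h'))"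
    if [simp]: "g' \<in> carrier G" "h' \<in> carrier G" "k' \<in> carrier G" for g' h' k'
  proof -
    have "T g' h' \<otimes>\<^bsub>H\<^esub> T (?c h' g') k' = T g' (k' \<otimes> h')"
      using T_mult_right[of g' h' "?c (inv h') k'"] by (simp add: G.word_simps)
    also have "\<dots> = T g' k' \<otimes>\<^bsub>H\<^esub> T (?c k' g') (?c k' h')" by (simp add: T_mult_right)
    finally show ?thesis by (simp add: H.inv_solve_left)
  qed
  have cg: "?c g ?g = ?g" by (simp add: conj_by_def)
  \<comment> \<open>Since \<open>conj_by G g k\<close> equals
    \<open>commutator G g k \<otimes> k\<close>, its action splits, and \<open>conj_by_T\<close>
    turns the commutator part into conjugation by \<open>T g k\<close>.\<close>
  have "T (?c (?c g k) ?g) (?c (?c g k) (?c g h))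
      = T (?c (commutator G g k) (?c k ?g)) (?c (commutator G g k) (?c k (?c g h)))"
    by (simp add: G.word_simps)
  also have "\<dots> = conj_by H (T g k) (T (inv (?c k g)) (?c (?c k g) (?c k h)))"
    by (simp add: conj_by_T G.conj_by_inv) (simp add: G.word_simps)
  also have "\<dots> = conj_by H (T g k) (inv\<^bsub>H\<^esub> T (?c k g) (?c k h))"
    by (simp add: T_inv_left)
  finally have third: "T (?c (?c g k) ?g) (?c (?c g k) (?c g h))
      = conj_by H (T g k) (inv\<^bsub>H\<^esub> T (?c k g) (?c k h))" .
  have "commutator G g h = g \<otimes> ?c h ?g" by (simp add: G.word_simps)
  then have "T (commutator G g h) k = T (?c g (?c h ?g)) (?c g k) \<otimes>\<^bsub>H\<^esub> T g k"
    by (simp add: T_mult_left)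
  also have "?c g (?c h ?g) = ?c (?c g h) ?g" by (simp add: G.word_simps)
  also have "T (?c (?c g h) ?g) (?c g k)
     = T g h \<otimes>\<^bsub>H\<^esub> (inv\<^bsub>H\<^esub> T g k \<otimes>\<^bsub>H\<^esub> conj_by H (T g k) (inv\<^bsub>H\<^esub> T (?c k g) (?c k h)))"
    by (simp add: expand[of ?g "?c g h" "?c g k"] T_inv_left third)
  finally show ?thesis by (simp add: H.word_simps)
qed

text \<open>By \<open>T_commutator_left\<close> the value is \<open>T g h\<close> times the inverse
  of its translate under \<open>commutator G x y\<close>, and that translate is the conjugate by
  \<open>T x y\<close>.\<close>

lemma T_commutators:
  assumes [simp]: "g \<in> carrier G" "h \<in> carrier G" "x \<in> carrier G" "y \<in> carrier G"
  shows "T (commutator G g h) (commutator G x y) = commutator H (T g h) (T x y)"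
  by (simp add: T_commutator_left conj_by_T [symmetric]) (simp add: H.word_simps)

end

lemma (in normal) conj_by_in: "g \<in> carrier G \<Longrightarrow> x \<in> H \<Longrightarrow> conj_by G g x \<in> H"
  by (simp add: conj_by_def inv_op_closed2)

lemma (in normal) commutator_in:
  assumes "g \<in> carrier G" "x \<in> H"
  shows "commutator G g x \<in> H" "commutator G x g \<in> H"
proof -
  have "commutator G g x = conj_by G g x \<otimes> inv x" by (simp add: commutator_def conj_by_def)
  then show "commutator G g x \<in> H" using assms conj_by_in by simp
  then have "inv commutator G g x \<in> H" by simp
  then show "commutator G x g \<in> H" using assms by (simp add: inv_commutator)
qed

lemma (in group) pow_eq_one_dvd:
  assumes "x \<in> carrier G" "x [^] (n::nat) = \<one>" "n dvd m"
  shows "x [^] m = \<one>"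
proof -
  obtain k where "m = n * k" using assms(3) ..
  then show ?thesis using assms nat_pow_pow[of x n k] by simp
qed

section \<open>Pairings that vanish on a normal subgroup containing the commutators of
  another\<close>

context crossed_pairing
begin

context
  fixes A B :: "'a set"
  assumes A: "A \<lhd> G" and B: "B \<lhd> G"
    and AB: "\<And>a a'. \<lbrakk>a \<in> A; a' \<in> A\<rbrakk> \<Longrightarrow> commutator G a a' \<in> B"
    and vanish [simp]: "\<And>b g. \<lbrakk>b \<in> B; g \<in> carrier G\<rbrakk> \<Longrightarrow> T b g = \<one>\<^bsub>H\<^esub>"
      "\<And>b g. \<lbrakk>b \<in> B; g \<in> carrier G\<rbrakk> \<Longrightarrow> T g b = \<one>\<^bsub>H\<^esub>"
begin

interpretation A: normal A G by (rule A)
interpretation B: normal B G by (rule B)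

text \<open>The extra factor is a value at a conjugate of \<open>b\<close>, which stays in
  \<open>B\<close>. Hence \<open>T\<close> depends only on cosets of \<open>B\<close>.\<close>

lemma T_absorb:
  assumes [simp]: "x \<in> carrier G" "y \<in> carrier G" "b \<in> B"
  shows "T (x \<otimes> b) y = T x y" "T y (x \<otimes> b) = T y x"
  by (simp_all add: T_mult_left[of x b y] T_mult_right[of y x b] B.conj_by_in)

text \<open>Conjugation by \<open>a\<close> changes \<open>p\<close> only by a commutator of
  elements of \<open>A\<close>, which lies in \<open>B\<close>.\<close>

lemma T_conj_by_section:
  assumes [simp]: "a \<in> A" "p \<in> A" "y \<in> carrier G"
  shows "T (conj_by G a p) y = T p y" "T y (conj_by G a p) = T y p"
proof -
  have "conj_by G a p = p \<otimes> commutator G (inv p) a" by (simp add: G.word_simps)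
  then show "T (conj_by G a p) y = T p y" "T y (conj_by G a p) = T y p"
    by (simp_all add: T_absorb AB)
qed

text \<open>Conjugation by \<open>T p q\<close> is the action of \<open>commutator G p q\<close>, an
  element of \<open>B\<close>; it moves every element of \<open>G\<close> within its coset of
  \<open>B\<close>.\<close>

lemma T_section_central:
  assumes [simp]: "p \<in> A" "q \<in> A" "x \<in> carrier G" "y \<in> carrier G"
  shows "T p q \<otimes>\<^bsub>H\<^esub> T x y = T x y \<otimes>\<^bsub>H\<^esub> T p q"
proof -
  have k: "commutator G p q \<in> B" by (simp add: AB)
  have "conj_by G k z = z \<otimes> commutator G (inv z) k" if "k \<in> B" "z \<in> carrier G" for k z
    using that by (simp add: G.word_simps)
  then have "conj_by H (T p q) (T x y) = T x y"
    using k by (simp add: conj_by_T T_absorb B.commutator_in)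
  then show ?thesis by (simp add: conj_by_def H.inv_solve_right')
qed

text \<open>With both arguments in \<open>A\<close> the conjugations in \<open>T_mult_left\<close>
  have no effect, so \<open>T\<close> is multiplicative in the first argument.\<close>

lemma T_section_pow:
  assumes [simp]: "p \<in> A" "q \<in> A"
  shows "T (p [^] (k::nat)) q = T p q [^]\<^bsub>H\<^esub> k"
proof (induction k)
  case (Suc k)
  have [simp]: "p [^] k \<in> A" by (induction k) simp_all
  show ?case
    by (simp add: T_mult_left T_conj_by_section Suc A.conj_by_in H.nat_pow_Suc2 [symmetric])
qed simp

text \<open>Splitting one \<open>a\<close> off \<open>a [^] Suc k\<close> replaces \<open>g\<close>
  by \<open>commutator G a g \<otimes> g\<close>. The new factor contributes the \<open>k\<close>-th
  power of a central value, and these exponents add up to a binomial coefficient.\<close>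

lemma T_pow_left:
  assumes [simp]: "a \<in> A" "g \<in> carrier G"
  shows "T (a [^] (k::nat)) g
    = T a (commutator G a g) [^]\<^bsub>H\<^esub> (k choose 2) \<otimes>\<^bsub>H\<^esub> T a g [^]\<^bsub>H\<^esub> k"
proof (induction k)
  case 0 then show ?case by (simp add: numeral_2_eq_2)
next
  case (Suc k)
  let ?q = "commutator G a g" and ?z = "T a (commutator G a g)"
  have [simp]: "a [^] k \<in> A" "?q \<in> A" by (induction k) (simp_all add: A.commutator_in)
  have "T (a [^] Suc k) g = T (a \<otimes> a [^] k) g" using G.nat_pow_Suc2[of a k] by simp
  also have "\<dots> = T (a [^] k) (?q \<otimes> g) \<otimes>\<^bsub>H\<^esub> T a g"
  proof -
    have "conj_by G a g = ?q \<otimes> g" by (simp add: G.word_simps)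
    then show ?thesis by (simp add: T_mult_left[of a "a [^] k"] T_conj_by_section)
  qed
  \<comment> \<open>Splitting off \<open>?q\<close> leaves its action on
    \<open>T (a [^] k) g\<close>. This is conjugation by \<open>T a g\<close>, which then merely
    moves the trailing \<open>T a g\<close> to the front.\<close>
  also have "T (a [^] k) (?q \<otimes> g) = ?z [^]\<^bsub>H\<^esub> k \<otimes>\<^bsub>H\<^esub> conj_by H (T a g) (T (a [^] k) g)"
    by (simp add: T_mult_right[of _ ?q g] T_section_pow conj_by_T)
  also have "\<dots> \<otimes>\<^bsub>H\<^esub> T a g = ?z [^]\<^bsub>H\<^esub> k \<otimes>\<^bsub>H\<^esub> (T a g \<otimes>\<^bsub>H\<^esub> T (a [^] k) g)"
    by (simp add: H.word_simps)
  also have "T a g \<otimes>\<^bsub>H\<^esub> T (a [^] k) g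
      = (T a g \<otimes>\<^bsub>H\<^esub> ?z [^]\<^bsub>H\<^esub> (k choose 2)) \<otimes>\<^bsub>H\<^esub> T a g [^]\<^bsub>H\<^esub> k"
    by (simp add: Suc H.m_assoc)
  also have "T a g \<otimes>\<^bsub>H\<^esub> ?z [^]\<^bsub>H\<^esub> (k choose 2) = ?z [^]\<^bsub>H\<^esub> (k choose 2) \<otimes>\<^bsub>H\<^esub> T a g"
    using T_section_central[of a ?q a g] H.group_commutes_pow[of ?z "T a g" "k choose 2"] by simp
  also have "?z [^]\<^bsub>H\<^esub> k \<otimes>\<^bsub>H\<^esub> (?z [^]\<^bsub>H\<^esub> (k choose 2) \<otimes>\<^bsub>H\<^esub> T a g \<otimes>\<^bsub>H\<^esub> T a g [^]\<^bsub>H\<^esub> k)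
      = (?z [^]\<^bsub>H\<^esub> k \<otimes>\<^bsub>H\<^esub> ?z [^]\<^bsub>H\<^esub> (k choose 2)) \<otimes>\<^bsub>H\<^esub> T a g [^]\<^bsub>H\<^esub> Suc k"
    by (simp add: H.m_assoc H.nat_pow_Suc2 [symmetric])
  also have "?z [^]\<^bsub>H\<^esub> k \<otimes>\<^bsub>H\<^esub> ?z [^]\<^bsub>H\<^esub> (k choose 2) = ?z [^]\<^bsub>H\<^esub> (Suc k choose 2)"
    by (simp add: H.nat_pow_mult numeral_2_eq_2)
  finally show ?case .
qed

end

section \<open>Subgroups spanned by values of a pairing\<close>

definition span :: "'a set \<Rightarrow> 'c set" where
  "span A = generate H ({T a g | a g. a \<in> A \<and> g \<in> carrier G} \<union> {T g a | a g. a \<in> A \<and> g \<in> carrier G})"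

lemma span_one: "span {\<one>} = {\<one>\<^bsub>H\<^esub>}"
proof -
  have "generate H {\<one>\<^bsub>H\<^esub>} = {\<one>\<^bsub>H\<^esub>}" using H.generate_one .
  moreover have "{T a g | a g. a \<in> {\<one>} \<and> g \<in> carrier G} \<union> {T g a | a g. a \<in> {\<one>} \<and> g \<in> carrier G}
      = {\<one>\<^bsub>H\<^esub>}"
    by auto (metis G.one_closed T_one_left)
  ultimately show ?thesis by (simp add: span_def)
qed

text \<open>By \<open>gen\<close> it suffices to conjugate by values of \<open>T\<close> and their
  inverses. Each acts on both arguments through an element of \<open>G\<close>, so normality of
  \<open>A\<close> sends generators to generators.\<close>

lemma span_normal:
  assumes gen: "carrier H = span (carrier G)" and A: "A \<lhd> G"
  shows "span A \<lhd> H"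
proof -
  interpret A: normal A G by (rule A)
  let ?S = "{T a g | a g. a \<in> A \<and> g \<in> carrier G} \<union> {T g a | a g. a \<in> A \<and> g \<in> carrier G}"
  have S: "?S \<subseteq> carrier H" by auto
  have conj_T: "conj_by H t s \<in> ?S" "conj_by H (inv\<^bsub>H\<^esub> t) s \<in> ?S"
    if "s \<in> ?S" "t = T g h" "g \<in> carrier G" "h \<in> carrier G" for s t g h
  proof -
    have inv: "conj_by H (inv\<^bsub>H\<^esub> T g h) (T x y) = T (conj_by G (commutator G h g) x) (conj_by G (commutator G h g) y)"
      if [simp]: "x \<in> carrier G" "y \<in> carrier G" for x y
    proof -
      let ?k = "commutator G h g"
      have "conj_by G (commutator G g h) (conj_by G ?k z) = z" if "z \<in> carrier G" for z
        using that \<open>g \<in> carrier G\<close> \<open>h \<in> carrier G\<close>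
        by (simp add: G.word_simps)
      then have "T x y = conj_by H (T g h) (T (conj_by G ?k x) (conj_by G ?k y))"
        using \<open>g \<in> carrier G\<close> \<open>h \<in> carrier G\<close> by (simp add: conj_by_T)
      then show ?thesis using \<open>g \<in> carrier G\<close> \<open>h \<in> carrier G\<close>
        by (simp add: H.conj_by_conj_by)
    qed
    from that(1) obtain a y where s: "s = T a y \<or> s = T y a" and a: "a \<in> A" and y: "y \<in> carrier G"
      by blast
    have mem: "T (conj_by G k a) (conj_by G k y) \<in> ?S" "T (conj_by G k y) (conj_by G k a) \<in> ?S"
      if "k \<in> carrier G" for k
      using A.conj_by_in[OF that a] G.conj_by_closed[OF that y] by blast+
    have aG: "a \<in> carrier G" using a by simp
    have k: "commutator G g h \<in> carrier G" "commutator G h g \<in> carrier G" using that by simp_all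
    show "conj_by H t s \<in> ?S"
      using s mem[OF k(1)] unfolding \<open>t = T g h\<close>
      by (elim disjE) (simp_all only: conj_by_T that aG y)
    show "conj_by H (inv\<^bsub>H\<^esub> t) s \<in> ?S"
      using s mem[OF k(2)] unfolding \<open>t = T g h\<close>
      by (elim disjE) (simp_all only: inv aG y)
  qed
  have "\<forall>s\<in>?S. conj_by H t s \<in> ?S" if "t \<in> carrier H" for t
    using that unfolding gen span_def
  proof induction
    case one
    show ?case
    proof
      fix s assume s: "s \<in> ?S"
      then have "conj_by H \<one>\<^bsub>H\<^esub> s = s" using S by (intro H.conj_by_one) (rule subsetD)
      then show "conj_by H \<one>\<^bsub>H\<^esub> s \<in> ?S" using s by (simp only:)
    qed
  next
    case (incl h) then show ?case using conj_T(1)[where t = h] by fast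
  next
    case (inv h) then show ?case using conj_T(2)[where t = h] by fast
  next
    case (eng h1 h2)
    then have h: "h1 \<in> carrier H" "h2 \<in> carrier H" by (simp_all add: gen span_def)
    show ?case
    proof
      fix s assume s: "s \<in> ?S"
      then have "s \<in> carrier H" using S by (rule subsetD[rotated])
      then have "conj_by H (h1 \<otimes>\<^bsub>H\<^esub> h2) s = conj_by H h1 (conj_by H h2 s)"
        using h by (simp only: H.conj_by_conj_by)
      then show "conj_by H (h1 \<otimes>\<^bsub>H\<^esub> h2) s \<in> ?S"
        using eng.IH s by (simp only:)
    qed
  qed
  then show ?thesis
    unfolding span_def using H.normal_generateI[OF S] by (simp only: conj_by_def)
qed

lemma crossed_pairing_hom:
  assumes "group Q" "f \<in> hom H Q"
  shows "crossed_pairing G Q (\<lambda>g h. f (T g h))"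
proof -
  interpret Q: group Q by fact
  show ?thesis
    by unfold_locales (simp_all add: hom_in_carrier[OF assms(2)] T_mult_left T_mult_right hom_mult[OF assms(2)])
qed

lemma span_hom:
  assumes "group Q" "f \<in> hom H Q" "A \<subseteq> carrier G"
  shows "crossed_pairing.span G Q (\<lambda>g h. f (T g h)) A = f ` span A"
proof -
  interpret Q: crossed_pairing G Q "\<lambda>g h. f (T g h)" by (rule crossed_pairing_hom[OF assms(1,2)])
  interpret group_hom H Q f by unfold_locales (rule assms(2))
  let ?S = "{T a g | a g. a \<in> A \<and> g \<in> carrier G} \<union> {T g a | a g. a \<in> A \<and> g \<in> carrier G}"
  have "{f (T a g) | a g. a \<in> A \<and> g \<in> carrier G} \<union> {f (T g a) | a g. a \<in> A \<and> g \<in> carrier G} = f ` ?S"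
    by blast
  moreover have "?S \<subseteq> carrier H" using assms(3) by auto
  ultimately show ?thesis unfolding Q.span_def span_def by (simp only: generate_img)
qed

text \<open>The generators have order dividing \<open>m\<close> by the power formula, and their
  commutators are values on pairs from \<open>A\<close>, hence central. So
  \<open>generate_pow_eq_one\<close> applies once these commutators are killed by
  \<open>m choose 2\<close>.\<close>

lemma section_exponent:
  assumes A: "A \<lhd> G" and B: "B \<lhd> G"
    and AB: "\<And>a a'. \<lbrakk>a \<in> A; a' \<in> A\<rbrakk> \<Longrightarrow> commutator G a a' \<in> B"
    and vanish: "\<And>b g. \<lbrakk>b \<in> B; g \<in> carrier G\<rbrakk> \<Longrightarrow> T b g = \<one>\<^bsub>H\<^esub>"
      "\<And>b g. \<lbrakk>b \<in> B; g \<in> carrier G\<rbrakk> \<Longrightarrow> T g b = \<one>\<^bsub>H\<^esub>"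
    and exp: "\<And>x. x \<in> carrier G \<Longrightarrow> x [^] (n::nat) = \<one>"
    and m: "n dvd m" and choose: "n dvd (m choose 2) \<or> A = carrier G"
    and x: "x \<in> span A"
  shows "x [^]\<^bsub>H\<^esub> m = \<one>\<^bsub>H\<^esub>"
proof -
  interpret A: normal A G by (rule A)
  interpret D: crossed_pairing G H "\<lambda>g h. inv\<^bsub>H\<^esub> T h g" by (rule dual)
  note hyps = A B AB vanish
  have dual_hyps: "\<And>b g. \<lbrakk>b \<in> B; g \<in> carrier G\<rbrakk> \<Longrightarrow> inv\<^bsub>H\<^esub> T b g = \<one>\<^bsub>H\<^esub>"
      "\<And>b g. \<lbrakk>b \<in> B; g \<in> carrier G\<rbrakk> \<Longrightarrow> inv\<^bsub>H\<^esub> T g b = \<one>\<^bsub>H\<^esub>" by (simp_all add: vanish)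
  have expm: "a [^] m = \<one>" if "a \<in> carrier G" for a
    using G.pow_eq_one_dvd[OF that exp m] that by blast
  \<comment> \<open>If \<open>A\<close> is all of \<open>G\<close>, commutators lie in
    \<open>B\<close> and the values are trivial, whatever \<open>m choose 2\<close> is. Otherwise
    \<open>T\<close> is multiplicative on \<open>A\<close>, so its values there have order dividing
    \<open>n\<close>.\<close>
  have torsion: "T p (commutator G y z) [^]\<^bsub>H\<^esub> (m choose 2) = \<one>\<^bsub>H\<^esub>"
      "T (commutator G y z) p [^]\<^bsub>H\<^esub> (m choose 2) = \<one>\<^bsub>H\<^esub>"
    if [simp]: "p \<in> A" "commutator G y z \<in> A" "y \<in> carrier G" "z \<in> carrier G" for p y z
  proof -
    have "T p (commutator G y z) [^]\<^bsub>H\<^esub> (m choose 2) = \<one>\<^bsub>H\<^esub> \<and>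
          T (commutator G y z) p [^]\<^bsub>H\<^esub> (m choose 2) = \<one>\<^bsub>H\<^esub>"
    proof (cases "A = carrier G")
      case True
      then have "commutator G y z \<in> B" by (simp add: AB)
      then show ?thesis by (simp add: vanish)
    next
      case False
      have "T q r [^]\<^bsub>H\<^esub> (m choose 2) = \<one>\<^bsub>H\<^esub>" if [simp]: "q \<in> A" "r \<in> A" for q r
      proof (rule H.pow_eq_one_dvd)
        show "n dvd (m choose 2)" using False choose by simp
        show "T q r [^]\<^bsub>H\<^esub> n = \<one>\<^bsub>H\<^esub>"
          using T_section_pow[OF hyps, of q r n] by (simp add: exp)
      qed simp
      then show ?thesis by simp
    qed
    then show "T p (commutator G y z) [^]\<^bsub>H\<^esub> (m choose 2) = \<one>\<^bsub>H\<^esub>"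
      "T (commutator G y z) p [^]\<^bsub>H\<^esub> (m choose 2) = \<one>\<^bsub>H\<^esub>" by simp_all
  qed
  have pow_left: "T a g [^]\<^bsub>H\<^esub> m = \<one>\<^bsub>H\<^esub>" if [simp]: "a \<in> A" "g \<in> carrier G" for a g
    using T_pow_left[OF hyps, of a g m] by (simp add: expm torsion A.commutator_in)
  \<comment> \<open>The power formula is applied to the dual pairing; the two vanishing hypotheses
    trade places because the arguments do.\<close>
  have pow_right: "T g a [^]\<^bsub>H\<^esub> m = \<one>\<^bsub>H\<^esub>" if [simp]: "a \<in> A" "g \<in> carrier G" for a g
  proof -
    have "inv\<^bsub>H\<^esub> (T g a [^]\<^bsub>H\<^esub> m) = \<one>\<^bsub>H\<^esub>"
      using D.T_pow_left[OF A B AB dual_hyps(2,1), of a g m]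
      by (simp add: expm torsion A.commutator_in H.nat_pow_inv)
    then show ?thesis using H.inv_eq_1_iff[of "T g a [^]\<^bsub>H\<^esub> m"] by simp
  qed
  let ?S = "{T a g | a g. a \<in> A \<and> g \<in> carrier G} \<union> {T g a | a g. a \<in> A \<and> g \<in> carrier G}"
  \<comment> \<open>Normality of \<open>A\<close> puts the commutator of the two arguments into
    \<open>A\<close>, in whichever order they occur. By \<open>T_commutators\<close>, commutators of
    generators are then values on pairs from \<open>A\<close>.\<close>
  have S: "\<exists>u v. s = T u v \<and> u \<in> carrier G \<and> v \<in> carrier G \<and> commutator G u v \<in> A" if "s \<in> ?S" for s
  proof -
    from that obtain a g where "s = T a g \<or> s = T g a" and a: "a \<in> A" and g: "g \<in> carrier G" by blast
    then show ?thesis using A.commutator_in[OF g a] A.mem_carrier[OF a] by blast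
  qed
  show ?thesis
  proof (rule H.generate_pow_eq_one)
    show "?S \<subseteq> carrier H" by auto
    show "x \<in> generate H ?S" using x by (simp add: span_def)
    show "s [^]\<^bsub>H\<^esub> m = \<one>\<^bsub>H\<^esub>" if "s \<in> ?S" for s using that pow_left pow_right by blast
    fix s t assume "s \<in> ?S" "t \<in> ?S"
    then obtain u v w z where st: "s = T u v" "t = T w z" "commutator G u v \<in> A" "commutator G w z \<in> A"
      and [simp]: "u \<in> carrier G" "v \<in> carrier G" "w \<in> carrier G" "z \<in> carrier G"
      using S[of s] S[of t] by auto
    have comm: "commutator H s t = T (commutator G u v) (commutator G w z)"
      by (simp add: st T_commutators)
    show "commutator H s t [^]\<^bsub>H\<^esub> (m choose 2) = \<one>\<^bsub>H\<^esub>"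
      unfolding comm using st by (simp add: torsion)
    fix r assume "r \<in> ?S"
    then obtain y y' where "r = T y y'" "y \<in> carrier G" "y' \<in> carrier G" using S[of r] by auto
    then show "commutator H s t \<otimes>\<^bsub>H\<^esub> r = r \<otimes>\<^bsub>H\<^esub> commutator H s t"
      unfolding comm using st T_section_central[OF hyps] by simp
  qed
qed

section \<open>Descent along the derived series\<close>

text \<open>In the quotient of \<open>H\<close> by \<open>span B\<close> the induced pairing
  vanishes on \<open>B\<close>, so \<open>section_exponent\<close> holds there; a trivial coset
  means that the power lies in \<open>span B\<close>.\<close>

lemma span_pow_step:
  assumes gen: "carrier H = span (carrier G)"
    and A: "A \<lhd> G" and B: "B \<lhd> G"
    and AB: "\<And>a a'. \<lbrakk>a \<in> A; a' \<in> A\<rbrakk> \<Longrightarrow> commutator G a a' \<in> B"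
    and exp: "\<And>x. x \<in> carrier G \<Longrightarrow> x [^] (n::nat) = \<one>"
    and m: "n dvd m" "n dvd (m choose 2) \<or> A = carrier G"
    and x: "x \<in> span A"
  shows "x [^]\<^bsub>H\<^esub> m \<in> span B"
proof -
  interpret A: normal A G by (rule A)
  interpret B: normal B G by (rule B)
  interpret K: normal "span B" H by (rule span_normal[OF gen B])
  let ?Q = "H Mod span B" and ?f = "\<lambda>x. span B #>\<^bsub>H\<^esub> x"
  have f: "?f \<in> hom H ?Q" by (rule K.r_coset_hom_Mod)
  have Q: "group ?Q" by (rule K.factorgroup_is_group)
  interpret f: group_hom H ?Q ?f using Q f by (simp add: group_hom_def group_hom_axioms_def H.group_axioms)
  interpret Q: crossed_pairing G ?Q "\<lambda>g h. ?f (T g h)" by (rule crossed_pairing_hom[OF Q f])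
  have xH: "x \<in> carrier H" using x span_normal[OF gen A] by (meson normal_imp_subgroup subgroup.mem_carrier)
  have "?f x \<in> Q.span A" using span_hom[OF Q f A.subset] x by simp
  then have "?f x [^]\<^bsub>?Q\<^esub> m = \<one>\<^bsub>?Q\<^esub>"
  proof (rule Q.section_exponent[OF A B AB _ _ exp m, rotated -1])
    fix b g assume "b \<in> B" "g \<in> carrier G"
    then have "T b g \<in> span B" "T g b \<in> span B" unfolding span_def by (blast intro: generate.incl)+
    then show "?f (T b g) = \<one>\<^bsub>?Q\<^esub>" "?f (T g b) = \<one>\<^bsub>?Q\<^esub>"
      by (simp_all add: FactGroup_def K.rcos_const)
  qed
  then have "?f (x [^]\<^bsub>H\<^esub> m) = span B" using f.hom_nat_pow[OF xH] by (simp add: FactGroup_def)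
  then show ?thesis using xH H.rcos_self[OF _ K.subgroup_axioms, of "x [^]\<^bsub>H\<^esub> m"] by simp
qed

text \<open>Each step down the derived series costs one exponent. For odd \<open>n\<close> every
  step costs \<open>n\<close>. In general the first step still costs \<open>n\<close>, because it
  starts from the whole group, and the other \<open>d - 1\<close> steps cost \<open>2 * n\<close>
  each.\<close>

theorem exponent_bound:
  assumes gen: "carrier H = span (carrier G)"
    and exp: "\<And>x. x \<in> carrier G \<Longrightarrow> x [^] (n::nat) = \<one>"
    and d: "(derived G ^^ d) (carrier G) = {\<one>}"
    and x: "x \<in> carrier H"
  shows "odd n \<Longrightarrow> x [^]\<^bsub>H\<^esub> (n ^ d) = \<one>\<^bsub>H\<^esub>"
    and "x [^]\<^bsub>H\<^esub> (2 ^ (d - 1) * n ^ d) = \<one>\<^bsub>H\<^esub>"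
proof -
  let ?D = "\<lambda>i. (derived G ^^ i) (carrier G)"
  have D: "?D i \<lhd> G" for i by (induction i) (simp_all add: G.normal_self G.derived_is_normal)
  have DD: "commutator G a a' \<in> ?D (Suc i)" if "a \<in> ?D i" "a' \<in> ?D i" for a a' i
    using that by (auto simp: G.derived_eq_generate_commutators intro!: generate.incl)
  have step: "y [^]\<^bsub>H\<^esub> m \<in> span (?D (Suc i))"
    if "y \<in> span (?D i)" "n dvd m" "n dvd (m choose 2) \<or> i = 0" for y m i
    by (rule span_pow_step[OF gen D D DD exp that(2) _ that(1)]) (use that(3) in auto)
  have span_carrier: "y \<in> carrier H" if "y \<in> span (?D i)" for y i
    using that normal_imp_subgroup[OF span_normal[OF gen D]] by (rule subgroup.mem_carrier[rotated])
  have iterate: "y [^]\<^bsub>H\<^esub> (m ^ k) \<in> span (?D (i + k))"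
    if "y \<in> span (?D i)" "n dvd m" "n dvd (m choose 2)" for y m i k
  proof (induction k)
    case 0
    then show ?case using that span_carrier[OF that(1)] by simp
  next
    case (Suc k)
    then show ?case
      using step[OF Suc, of m] that span_carrier[OF that(1)] by (simp add: H.nat_pow_pow mult.commute)
  qed
  have span_d: "span (?D d) = {\<one>\<^bsub>H\<^esub>}" using d span_one by simp
  show "x [^]\<^bsub>H\<^esub> (n ^ d) = \<one>\<^bsub>H\<^esub>" if "odd n"
  proof -
    \<comment> \<open>For odd \<open>n\<close> the factor 2 in \<open>n * (n - 1) div 2\<close> is
      taken from \<open>n - 1\<close>.\<close>
    have "n dvd (n choose 2)"
    proof -
      have "n * (n - 1) div 2 = n * ((n - 1) div 2)" using that by (simp add: div_mult_swap)
      then show ?thesis by (simp add: choose_two)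
    qed
    then show ?thesis using iterate[of x 0 n d] x gen span_d by simp
  qed
  show "x [^]\<^bsub>H\<^esub> (2 ^ (d - 1) * n ^ d) = \<one>\<^bsub>H\<^esub>"
  \<comment> \<open>For \<open>d = 0\<close> the truncated \<open>d - 1\<close> gives the exponent
    1, which is right because \<open>H\<close> is then trivial.\<close>
  proof (cases d)
    case 0
    then show ?thesis using x gen span_d by simp
  next
    case (Suc k)
    have "x [^]\<^bsub>H\<^esub> n \<in> span (?D 1)" using step[of x 0 n] x gen by simp
    \<comment> \<open>Here \<open>(2 * n) choose 2\<close> is \<open>n * (2 * n - 1)\<close>;
      doubling compensates for the division by 2.\<close>
    moreover have "n dvd ((2 * n) choose 2)" by (simp add: choose_two)
    ultimately have "(x [^]\<^bsub>H\<^esub> n) [^]\<^bsub>H\<^esub> ((2 * n) ^ k) \<in> span (?D (1 + k))"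
      by (intro iterate) simp_all
    then show ?thesis using Suc span_d x by (simp add: H.nat_pow_pow power_mult_distrib ac_simps)
  qed
qed

end

section \<open>Exponents of groups and divisibility\<close>

lemma pow_group_exponent:
  assumes "group_exponent G > 0" "x \<in> carrier G"
  shows "x [^]\<^bsub>G\<^esub> group_exponent G = \<one>\<^bsub>G\<^esub>"
proof -
  have ex: "\<exists>n>0. \<forall>x\<in>carrier G. x [^]\<^bsub>G\<^esub> (n::nat) = \<one>\<^bsub>G\<^esub>"
    using assms(1) by (auto simp: group_exponent_def split: if_splits)
  from LeastI_ex[OF this] show ?thesis using ex assms(2) by (simp add: group_exponent_def)
qed

text \<open>Division with remainder: the power \<open>N mod e\<close> also kills every element, so
  minimality of \<open>e\<close> forces the remainder to be 0.\<close>

lemma (in group) group_exponent_dvd: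
  assumes "N > 0" and N: "\<And>x. x \<in> carrier G \<Longrightarrow> x [^] (N::nat) = \<one>"
  shows "group_exponent G dvd N"
proof -
  define e where "e = group_exponent G"
  have ex: "\<exists>n>0. \<forall>x\<in>carrier G. x [^] (n::nat) = \<one>" using assms by blast
  then have e: "e = (LEAST n. n > 0 \<and> (\<forall>x\<in>carrier G. x [^] n = \<one>))"
    by (simp add: e_def group_exponent_def)
  have e0: "e > 0" using LeastI_ex[OF ex] by (simp add: e)
  have "x [^] (N mod e) = \<one>" if x: "x \<in> carrier G" for x
  proof -
    have "\<one> = x [^] (e * (N div e) + N mod e)" using N[OF x] by simp
    also have "\<dots> = (x [^] e) [^] (N div e) \<otimes> x [^] (N mod e)"
      using x by (simp only: nat_pow_mult[symmetric] nat_pow_pow)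
    also have "x [^] e = \<one>" using pow_group_exponent[of G x] e0 x by (simp add: e_def)
    finally show ?thesis using x by simp
  qed
  then have "\<not> N mod e > 0"
    using not_less_Least[of "N mod e" "\<lambda>n. n > 0 \<and> (\<forall>x\<in>carrier G. x [^] n = \<one>)"]
      e0 mod_less_divisor[OF e0, of N] by (simp add: e[symmetric])
  then show ?thesis by (simp add: e_def mod_eq_0_iff_dvd)
qed

section \<open>The tensor square\<close>

definition tensor :: "('a, 'b) monoid_scheme \<Rightarrow> 'a \<Rightarrow> 'a \<Rightarrow> ('a \<times> 'a) word set" where
  "tensor G g h =
     pres_cong (carrier G \<times> carrier G) (tensor_relations G) `` {[tensor_symbol g h]}"

lemma (in group) crossed_pairing_tensor: "crossed_pairing G (tensor_square G) (tensor G)"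
proof -
  let ?S = "carrier G \<times> carrier G" and ?R = "tensor_relations G"
  interpret Q: group "tensor_square G" by (rule group_tensor_square)
  have singleton: "[tensor_symbol g h] \<in> words ?S" if "g \<in> carrier G" "h \<in> carrier G" for g h
    using that by (simp add: words_def)
  \<comment> \<open>Both kinds of relation equate one letter with a product of two, so one transfer
    from words to classes serves both.\<close>
  have rel: "tensor G g h = tensor G u v \<otimes>\<^bsub>tensor_square G\<^esub> tensor G u' v'"
    if "([tensor_symbol g h], [tensor_symbol u v, tensor_symbol u' v']) \<in> ?R"
      and mem: "g \<in> carrier G" "h \<in> carrier G" "u \<in> carrier G" "v \<in> carrier G" "u' \<in> carrier G" "v' \<in> carrier G"
    for g h u v u' v'
  proof -
    have "([tensor_symbol g h], [tensor_symbol u v, tensor_symbol u' v']) \<in> pres_cong ?S ?R"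
      using that by (intro pres_cong.relation) (auto simp: words_def)
    then have "tensor G g h = pres_cong ?S ?R `` {[tensor_symbol u v] @ [tensor_symbol u' v']}"
      by (simp add: tensor_def equiv_class_eq[OF equiv_pres_cong])
    then show ?thesis
      using mem by (simp only: tensor_def tensor_square_def mult_presented_group singleton)
  qed
  show ?thesis
  proof unfold_locales
    show "tensor G g h \<in> carrier (tensor_square G)" if "g \<in> carrier G" "h \<in> carrier G" for g h
      using that by (simp add: tensor_def tensor_square_def class_in_presented_group singleton)
    show "tensor G (g \<otimes> g') h
        = tensor G (conj_by G g g') (conj_by G g h) \<otimes>\<^bsub>tensor_square G\<^esub> tensor G g h"
      if "g \<in> carrier G" "g' \<in> carrier G" "h \<in> carrier G" for g g' h
      using that by (intro rel) (auto simp: tensor_relations_def)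
    show "tensor G g (h \<otimes> h')
        = tensor G g h \<otimes>\<^bsub>tensor_square G\<^esub> tensor G (conj_by G h g) (conj_by G h h')"
      if "g \<in> carrier G" "h \<in> carrier G" "h' \<in> carrier G" for g h h'
      using that by (intro rel) (auto simp: tensor_relations_def)
  qed
qed

text \<open>Induction over words: a positive letter is a value of \<open>tensor\<close>, and a
  negative letter is the inverse of one by the cancellation rule.\<close>

lemma (in group) carrier_tensor_square:
  "carrier (tensor_square G) = crossed_pairing.span G (tensor_square G) (tensor G) (carrier G)"
proof -
  let ?S = "carrier G \<times> carrier G" and ?R = "tensor_relations G" and ?Q = "tensor_square G"
  interpret T: crossed_pairing G ?Q "tensor G" by (rule crossed_pairing_tensor)
  let ?cl = "\<lambda>u. pres_cong ?S ?R `` {u}"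
  have cons: "?cl (a # u) = ?cl [a] \<otimes>\<^bsub>?Q\<^esub> ?cl u" if "[a] \<in> words ?S" "u \<in> words ?S" for a u
    using mult_presented_group[OF that] by (simp add: tensor_square_def)
  have letter: "?cl [(b, g, h)] \<in> T.span (carrier G)" if "g \<in> carrier G" "h \<in> carrier G" for b g h
  proof (cases b)
    case True
    have "tensor G g h \<in> T.span (carrier G)"
      unfolding T.span_def using that by (blast intro: generate.incl)
    then show ?thesis using True by (simp add: tensor_def)
  next
    case False
    have w: "[(False, g, h)] \<in> words ?S" "[(True, g, h)] \<in> words ?S" using that by (simp_all add: words_def)
    have "([(False, g, h), (True, g, h)], []) \<in> pres_cong ?S ?R"
      using pres_cong.cancel[of "(g, h)" ?S False] that by simp
    then have "?cl [(False, g, h)] \<otimes>\<^bsub>?Q\<^esub> tensor G g h = \<one>\<^bsub>?Q\<^esub>"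
      using cons[OF w] equiv_class_eq[OF equiv_pres_cong, of "[(False, g, h), (True, g, h)]" "[]"]
      by (simp add: tensor_def tensor_square_def one_presented_group)
    then have "?cl [(False, g, h)] = inv\<^bsub>?Q\<^esub> tensor G g h"
      using that w by (intro T.H.inv_equality[symmetric] T.T_closed)
        (simp_all add: tensor_square_def class_in_presented_group)
    moreover have "inv\<^bsub>?Q\<^esub> tensor G g h \<in> T.span (carrier G)"
      unfolding T.span_def using that by (blast intro: generate.inv)
    ultimately show ?thesis using False by simp
  qed
  have "?cl u \<in> T.span (carrier G)" if "u \<in> words ?S" for u
    using that
  proof (induction u)
    case Nil
    show ?case
      unfolding T.span_def one_presented_group[symmetric] tensor_square_def[symmetric] by (rule generate.one)
  next
    case (Cons a u)
    then have a: "[a] \<in> words ?S" and u: "u \<in> words ?S" by (simp_all add: words_def)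
    obtain b g h where "a = (b, g, h)" by (cases a)
    then have "?cl [a] \<in> T.span (carrier G)" using a letter by (simp add: words_def)
    then show ?case using Cons.IH[OF u] unfolding cons[OF a u] T.span_def by (intro generate.eng)
  qed
  then have "carrier ?Q \<subseteq> T.span (carrier G)"
    unfolding tensor_square_def by (auto elim: carrier_presented_groupE)
  moreover have "T.span (carrier G) \<subseteq> carrier ?Q"
    unfolding T.span_def by (rule T.H.generate_incl) auto
  ultimately show ?thesis by simp
qed

section \<open>Central extensions\<close>

text \<open>Two lifts of one element differ by a central factor, which drops out of commutators. The
  second argument is reduced to the first by inverting.\<close>

lemma central_commutator_eq:
  assumes E: "group E" and G: "group G" and p: "p \<in> hom E G"
    and central: "\<And>x y. \<lbrakk>x \<in> carrier E; y \<in> carrier E; p x = \<one>\<^bsub>G\<^esub>\<rbrakk> \<Longrightarrow> x \<otimes>\<^bsub>E\<^esub> y = y \<otimes>\<^bsub>E\<^esub> x"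
    and mem: "x \<in> carrier E" "x' \<in> carrier E" "y \<in> carrier E" "y' \<in> carrier E"
    and eq: "p x = p x'" "p y = p y'"
  shows "commutator E x y = commutator E x' y'"
proof -
  interpret group_hom E G p using E G p by (simp add: group_hom_def group_hom_axioms_def)
  have left: "commutator E u w = commutator E v w"
    if uvw: "u \<in> carrier E" "v \<in> carrier E" "w \<in> carrier E" and "p u = p v" for u v w
  proof -
    define z where "z = u \<otimes>\<^bsub>E\<^esub> inv\<^bsub>E\<^esub> v"
    have z: "z \<in> carrier E" "p z = \<one>\<^bsub>G\<^esub>" "u = z \<otimes>\<^bsub>E\<^esub> v"
      using that by (simp_all add: z_def G.m_assoc)
    have "z \<otimes>\<^bsub>E\<^esub> c = c \<otimes>\<^bsub>E\<^esub> z" if "c \<in> carrier E" for c using central z that by blast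
    then have "conj_by E z c = c" "commutator E z c = \<one>\<^bsub>E\<^esub>" if "c \<in> carrier E" for c
      using that z by (simp_all add: conj_by_def G.commutator_eq_one_iff G.m_assoc)
    then show ?thesis unfolding \<open>u = z \<otimes>\<^bsub>E\<^esub> v\<close> using uvw z by (simp add: G.commutator_mult_left)
  qed
  have "commutator E x y = inv\<^bsub>E\<^esub> commutator E y x'"
    using left[OF mem(1,2,3) eq(1)] mem by (simp add: G.inv_commutator)
  also have "\<dots> = inv\<^bsub>E\<^esub> commutator E y' x'" using left[OF mem(3,4,2) eq(2)] by simp
  finally show ?thesis using mem by (simp add: G.inv_commutator)
qed

text \<open>The section \<open>s\<close> is only a map of sets. Since commutators do not depend on
  the lifts, \<open>s\<close> may be treated as multiplicative inside them, and the commutator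
  identities of \<open>E\<close> become the pairing relations.\<close>

lemma central_extension_crossed_pairing:
  assumes E: "group E" and G: "group G" and p: "p \<in> hom E G"
    and central: "\<And>x y. \<lbrakk>x \<in> carrier E; y \<in> carrier E; p x = \<one>\<^bsub>G\<^esub>\<rbrakk> \<Longrightarrow> x \<otimes>\<^bsub>E\<^esub> y = y \<otimes>\<^bsub>E\<^esub> x"
    and s: "\<And>g. g \<in> carrier G \<Longrightarrow> s g \<in> carrier E" "\<And>g. g \<in> carrier G \<Longrightarrow> p (s g) = g"
  defines "D \<equiv> E \<lparr>carrier := derived E (carrier E)\<rparr>"
  shows "crossed_pairing G D (\<lambda>g h. commutator E (s g) (s h))"
    and "carrier D = crossed_pairing.span G D (\<lambda>g h. commutator E (s g) (s h)) (carrier G)"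
proof -
  interpret p: group_hom E G p using E G p by (simp add: group_hom_def group_hom_axioms_def)
  note eq = central_commutator_eq[OF E G p central]
  have DE: "subgroup (derived E (carrier E)) E" by (rule p.G.derived_is_subgroup) simp
  have D: "group D" unfolding D_def by (rule p.G.subgroup_imp_group[OF DE])
  have mem: "commutator E x y \<in> derived E (carrier E)" if "x \<in> carrier E" "y \<in> carrier E" for x y
    using that unfolding p.G.derived_eq_generate_commutators by (blast intro: generate.incl)
  have p_conj: "p (conj_by E x y) = conj_by G (p x) (p y)" if "x \<in> carrier E" "y \<in> carrier E" for x y
    using that by (simp add: conj_by_def)
  have s_conj: "commutator E (s (conj_by G a b)) (s (conj_by G a c))
      = conj_by E (s a) (commutator E (s b) (s c))"
    if "a \<in> carrier G" "b \<in> carrier G" "c \<in> carrier G" for a b c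
    using that s unfolding p.G.conj_by_commutator[OF s(1)[OF that(1)] s(1)[OF that(2)] s(1)[OF that(3)]]
    by (intro eq) (simp_all add: p_conj)
  show cp: "crossed_pairing G D (\<lambda>g h. commutator E (s g) (s h))"
  proof (intro crossed_pairing.intro crossed_pairing_axioms.intro G D)
    fix g h assume g: "g \<in> carrier G" and h: "h \<in> carrier G"
    show "commutator E (s g) (s h) \<in> carrier D" using g h s mem by (simp add: D_def)
    fix k assume k: "k \<in> carrier G"
    have "commutator E (s (g \<otimes>\<^bsub>G\<^esub> h)) (s k) = commutator E (s g \<otimes>\<^bsub>E\<^esub> s h) (s k)"
      using g h k s by (intro eq) simp_all
    then show "commutator E (s (g \<otimes>\<^bsub>G\<^esub> h)) (s k)
        = commutator E (s (conj_by G g h)) (s (conj_by G g k)) \<otimes>\<^bsub>D\<^esub> commutator E (s g) (s k)"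
      using g h k s by (simp add: p.G.commutator_mult_left s_conj D_def)
    have "commutator E (s g) (s (h \<otimes>\<^bsub>G\<^esub> k)) = commutator E (s g) (s h \<otimes>\<^bsub>E\<^esub> s k)"
      using g h k s by (intro eq) simp_all
    then show "commutator E (s g) (s (h \<otimes>\<^bsub>G\<^esub> k))
        = commutator E (s g) (s h) \<otimes>\<^bsub>D\<^esub> commutator E (s (conj_by G h g)) (s (conj_by G h k))"
      using g h k s by (simp add: p.G.commutator_mult_right s_conj D_def)
  qed
  interpret T: crossed_pairing G D "\<lambda>g h. commutator E (s g) (s h)" by (rule cp)
  let ?S = "{commutator E x y | x y. x \<in> carrier E \<and> y \<in> carrier E}"
  have ex: "\<exists>g\<in>carrier G. \<exists>h\<in>carrier G. commutator E x y = commutator E (s g) (s h)"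
    if "x \<in> carrier E" "y \<in> carrier E" for x y
    using that s by (intro bexI[of _ "p x"] bexI[of _ "p y"] eq) auto
  have S: "{commutator E (s a) (s g) | a g. a \<in> carrier G \<and> g \<in> carrier G}
      \<union> {commutator E (s g) (s a) | a g. a \<in> carrier G \<and> g \<in> carrier G} = ?S" (is "?L = _")
  proof
    show "?L \<subseteq> ?S" using s(1) by blast
    show "?S \<subseteq> ?L"
    proof
      fix c assume "c \<in> ?S"
      then obtain x y where "c = commutator E x y" "x \<in> carrier E" "y \<in> carrier E" by blast
      with ex[of x y] show "c \<in> ?L" by blast
    qed
  qed
  have "generate D ?S = generate E ?S"
    unfolding D_def using mem DE by (intro p.G.generate_consistent) auto
  then show "carrier D = T.span (carrier G)"
    unfolding T.span_def S by (simp add: D_def p.G.derived_eq_generate_commutators)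
qed

section \<open>Central extensions from 2-cocycles\<close>

text \<open>The action on \<open>M\<close> is trivial. The identity says that the linear extension
  of \<open>f\<close> to 2-chains kills \<open>bar_boundary3\<close> of each generator
  \<open>(g, h, k)\<close>.\<close>

locale cocycle = M: comm_group M + G: group G for M (structure) and G (structure) +
  fixes f
  assumes f_closed [simp]: "\<lbrakk>g \<in> carrier G; h \<in> carrier G\<rbrakk> \<Longrightarrow> f g h \<in> carrier M"
    and f_cocycle: "\<lbrakk>g \<in> carrier G; h \<in> carrier G; k \<in> carrier G\<rbrakk>
      \<Longrightarrow> f h k \<otimes> f g (h \<otimes>\<^bsub>G\<^esub> k) = f (g \<otimes>\<^bsub>G\<^esub> h) k \<otimes> f g h"
begin

text \<open>The cocycle is not assumed to be normalised, which accounts for the shape of the identity.\<close>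

definition extension where
  "extension = \<lparr>carrier = carrier M \<times> carrier G,
     monoid.mult = (\<lambda>(m, g) (m', g'). (m \<otimes> m' \<otimes> f g g', g \<otimes>\<^bsub>G\<^esub> g')),
     one = (inv f \<one>\<^bsub>G\<^esub> \<one>\<^bsub>G\<^esub>, \<one>\<^bsub>G\<^esub>)\<rparr>"

lemma carrier_extension [simp]: "carrier extension = carrier M \<times> carrier G"
  by (simp add: extension_def)

lemma mult_extension [simp]:
  "(m, g) \<otimes>\<^bsub>extension\<^esub> (m', g') = (m \<otimes> m' \<otimes> f g g', g \<otimes>\<^bsub>G\<^esub> g')"
  by (simp add: extension_def)

lemma one_extension: "\<one>\<^bsub>extension\<^esub> = (inv f \<one>\<^bsub>G\<^esub> \<one>\<^bsub>G\<^esub>, \<one>\<^bsub>G\<^esub>)"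
  by (simp add: extension_def)

lemma f_one_left: "g \<in> carrier G \<Longrightarrow> f \<one>\<^bsub>G\<^esub> g = f \<one>\<^bsub>G\<^esub> \<one>\<^bsub>G\<^esub>"
  using f_cocycle[of "\<one>\<^bsub>G\<^esub>" "\<one>\<^bsub>G\<^esub>" g] by simp

lemma f_one_right: "g \<in> carrier G \<Longrightarrow> f g \<one>\<^bsub>G\<^esub> = f \<one>\<^bsub>G\<^esub> \<one>\<^bsub>G\<^esub>"
  using f_cocycle[of g "\<one>\<^bsub>G\<^esub>" "\<one>\<^bsub>G\<^esub>"] by simp

lemma group_extension: "group extension"
proof (rule groupI)
  fix x y assume "x \<in> carrier extension" "y \<in> carrier extension"
  then show "x \<otimes>\<^bsub>extension\<^esub> y \<in> carrier extension" by auto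
next
  fix x y z assume "x \<in> carrier extension" "y \<in> carrier extension" "z \<in> carrier extension"
  then obtain a g b h c k where xyz: "x = (a, g)" "y = (b, h)" "z = (c, k)"
    and [simp]: "a \<in> carrier M" "b \<in> carrier M" "c \<in> carrier M"
      "g \<in> carrier G" "h \<in> carrier G" "k \<in> carrier G" by auto
  have "a \<otimes> b \<otimes> f g h \<otimes> c \<otimes> f (g \<otimes>\<^bsub>G\<^esub> h) k = a \<otimes> b \<otimes> c \<otimes> (f (g \<otimes>\<^bsub>G\<^esub> h) k \<otimes> f g h)"
    by (simp add: M.m_ac)
  also have "f (g \<otimes>\<^bsub>G\<^esub> h) k \<otimes> f g h = f h k \<otimes> f g (h \<otimes>\<^bsub>G\<^esub> k)"
    by (simp add: f_cocycle)
  also have "a \<otimes> b \<otimes> c \<otimes> \<dots> = a \<otimes> (b \<otimes> c \<otimes> f h k) \<otimes> f g (h \<otimes>\<^bsub>G\<^esub> k)"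
    by (simp add: M.m_ac)
  finally show "x \<otimes>\<^bsub>extension\<^esub> y \<otimes>\<^bsub>extension\<^esub> z = x \<otimes>\<^bsub>extension\<^esub> (y \<otimes>\<^bsub>extension\<^esub> z)"
    by (simp add: xyz G.m_assoc)
next
  show "\<one>\<^bsub>extension\<^esub> \<in> carrier extension" by (simp add: one_extension)
next
  fix x assume "x \<in> carrier extension"
  then obtain a g where x: "x = (a, g)" and [simp]: "a \<in> carrier M" "g \<in> carrier G" by auto
  show "\<one>\<^bsub>extension\<^esub> \<otimes>\<^bsub>extension\<^esub> x = x"
    by (simp add: x one_extension f_one_left[of g] M.m_ac)
  \<comment> \<open>Solving for a left inverse of \<open>(a, g)\<close>: \<open>c\<close> stands for
    the value of \<open>f\<close> at \<open>inv g\<close> and \<open>g\<close>, and \<open>e\<close>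
    for the first component of the identity.\<close>
  have "inv a \<otimes> inv c \<otimes> e \<otimes> a \<otimes> c = e" if "c \<in> carrier M" "e \<in> carrier M" for c e
  proof -
    have "inv a \<otimes> inv c \<otimes> e \<otimes> a \<otimes> c = (inv a \<otimes> a) \<otimes> ((inv c \<otimes> c) \<otimes> e)"
      using that by (simp only: M.m_ac M.m_closed M.inv_closed \<open>a \<in> carrier M\<close>)
    then show ?thesis using that by simp
  qed
  then have "(inv a \<otimes> inv f (inv\<^bsub>G\<^esub> g) g \<otimes> inv f \<one>\<^bsub>G\<^esub> \<one>\<^bsub>G\<^esub>, inv\<^bsub>G\<^esub> g) \<otimes>\<^bsub>extension\<^esub> x = \<one>\<^bsub>extension\<^esub>"
    by (simp add: x one_extension)
  then show "\<exists>y\<in>carrier extension. y \<otimes>\<^bsub>extension\<^esub> x = \<one>\<^bsub>extension\<^esub>"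
    by (rule bexI) simp
qed

lemma hom_snd_extension: "snd \<in> hom extension G"
  by (rule homI) auto

lemma central_extension:
  assumes "x \<in> carrier extension" "y \<in> carrier extension" "snd x = \<one>\<^bsub>G\<^esub>"
  shows "x \<otimes>\<^bsub>extension\<^esub> y = y \<otimes>\<^bsub>extension\<^esub> x"
proof -
  obtain m m' g where "x = (m, \<one>\<^bsub>G\<^esub>)" "y = (m', g)" "m \<in> carrier M" "m' \<in> carrier M" "g \<in> carrier G"
    using assms by (cases x, cases y) auto
  then show ?thesis by (simp add: f_one_left[of g] f_one_right[of g] M.m_ac)
qed

text \<open>The product of two pairs \<open>(m, \<one>)\<close> and \<open>(m', \<one>)\<close>
  carries an extra factor, the value of \<open>f\<close> at the identity; dividing by it yields a
  homomorphism.\<close>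

definition embed where "embed m = (m \<otimes> inv f \<one>\<^bsub>G\<^esub> \<one>\<^bsub>G\<^esub>, \<one>\<^bsub>G\<^esub>)"

lemma hom_embed: "embed \<in> hom M extension"
proof (rule homI)
  let ?c = "f \<one>\<^bsub>G\<^esub> \<one>\<^bsub>G\<^esub>"
  fix m m' assume [simp]: "m \<in> carrier M" "m' \<in> carrier M"
  show "embed m \<in> carrier extension" by (simp add: embed_def)
  have "m \<otimes> inv ?c \<otimes> (m' \<otimes> inv ?c) \<otimes> ?c = m \<otimes> (inv ?c \<otimes> m')"
    by (simp add: M.m_assoc)
  also have "inv ?c \<otimes> m' = m' \<otimes> inv ?c" by (simp add: M.m_comm)
  finally show "embed (m \<otimes> m') = embed m \<otimes>\<^bsub>extension\<^esub> embed m'"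
    by (simp add: embed_def M.m_assoc)
qed

lemma embed_eq_one: "m \<in> carrier M \<Longrightarrow> embed m = \<one>\<^bsub>extension\<^esub> \<Longrightarrow> m = \<one>"
  by (simp add: embed_def one_extension)

lemma embed_mult:
  "\<lbrakk>m \<in> carrier M; g \<in> carrier G\<rbrakk> \<Longrightarrow> embed m \<otimes>\<^bsub>extension\<^esub> (\<one>, g) = (m, g)"
  by (simp add: embed_def f_one_left[of g] M.m_assoc)

end

section \<open>The Schur multiplier\<close>

text \<open>Along the projection onto the abelianisation of the extension, \<open>f\<close> becomes the
  coboundary of \<open>g \<mapsto> [(\<one>, g)]\<close>; hence 2-cycles are sent to products of commutators.\<close>

lemma (in cocycle) embed_cycle_in_derived:
  assumes q: "q \<in> hom (free_Abelian_group (carrier G \<times> carrier G)) M"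
    and qf: "\<And>g h. \<lbrakk>g \<in> carrier G; h \<in> carrier G\<rbrakk> \<Longrightarrow> q (frag_of (g, h)) = f g h"
    and z: "z \<in> bar_cycles2 G"
  shows "embed (q z) \<in> derived extension (carrier extension)"
proof -
  let ?F1 = "free_Abelian_group (carrier G)"
  let ?F2 = "free_Abelian_group (carrier G \<times> carrier G)"
  let ?D = "derived extension (carrier extension)"
  let ?Q = "extension Mod ?D"
  let ?c = "\<lambda>x. ?D #>\<^bsub>extension\<^esub> x"
  interpret F1: comm_group ?F1 by (rule abelian_free_Abelian_group)
  interpret F2: comm_group ?F2 by (rule abelian_free_Abelian_group)
  interpret E: group extension by (rule group_extension)
  interpret Q: comm_group ?Q by (rule E.derived_quot_is_comm_group)
  interpret D: normal ?D extension by (rule E.derived_is_normal[OF E.normal_self])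
  have c: "?c \<in> hom extension ?Q" by (rule D.r_coset_hom_Mod)
  have c_closed: "?c x \<in> carrier ?Q" if "x \<in> carrier extension" for x
    using hom_in_carrier[OF c that] .
  obtain \<phi> where \<phi>: "\<phi> \<in> hom ?F1 ?Q" and \<phi>_frag: "\<And>g. g \<in> carrier G \<Longrightarrow> \<phi> (frag_of g) = ?c (\<one>, g)"
  proof (rule Q.free_Abelian_group_universal)
    show "(\<lambda>g. ?c (\<one>, g)) ` carrier G \<subseteq> carrier ?Q"
      by (intro image_subsetI c_closed) simp
  qed (rule that)
  interpret \<phi>: group_hom ?F1 ?Q \<phi>
    by (intro group_hom.intro group_hom_axioms.intro group_free_Abelian_group Q.group_axioms \<phi>)
  interpret q: group_hom ?F2 M q
    using q by (simp add: group_hom_def group_hom_axioms_def M.group_axioms)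
  interpret d2: group_hom ?F2 ?F1 "bar_boundary2 G"
    by (simp add: group_hom_def group_hom_axioms_def G.bar_boundary2_hom)
  interpret e: group_hom ?F2 ?Q "\<lambda>u. ?c (embed (q u))"
    using hom_compose[OF hom_compose[OF q hom_embed] c] unfolding o_def
    by (intro group_hom.intro group_hom_axioms.intro group_free_Abelian_group Q.group_axioms)
  \<comment> \<open>The product of the lifts of \<open>g\<close> and \<open>h\<close> is
    \<open>embed (f g h)\<close> times the lift of their product. In the abelian quotient this
    exhibits \<open>f\<close> as the coboundary of the lift.\<close>
  have gen: "?c (embed (f g h)) = \<phi> (bar_boundary2 G (frag_of (g, h)))"
    if [simp]: "g \<in> carrier G" "h \<in> carrier G" for g h
  proof -
    let ?x = "\<lambda>g. ?c (\<one>, g)"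
    have x: "?x k \<in> carrier ?Q" if "k \<in> carrier G" for k using c_closed that by simp
    have "(\<one>, g) \<otimes>\<^bsub>extension\<^esub> (\<one>, h) = embed (f g h) \<otimes>\<^bsub>extension\<^esub> (\<one>, g \<otimes>\<^bsub>G\<^esub> h)"
      by (simp add: embed_mult)
    note factor = this
    have e: "embed (f g h) \<in> carrier extension" using hom_in_carrier[OF hom_embed] by simp
    have "?x g \<otimes>\<^bsub>?Q\<^esub> ?x h = ?c ((\<one>, g) \<otimes>\<^bsub>extension\<^esub> (\<one>, h))"
      by (rule hom_mult[OF c, symmetric]) simp_all
    also have "\<dots> = ?c (embed (f g h)) \<otimes>\<^bsub>?Q\<^esub> ?x (g \<otimes>\<^bsub>G\<^esub> h)"
      unfolding factor by (rule hom_mult[OF c e]) simp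
    finally have "?x g \<otimes>\<^bsub>?Q\<^esub> ?x h = ?c (embed (f g h)) \<otimes>\<^bsub>?Q\<^esub> ?x (g \<otimes>\<^bsub>G\<^esub> h)" .
    then have "?c (embed (f g h)) = ?x g \<otimes>\<^bsub>?Q\<^esub> ?x h \<otimes>\<^bsub>?Q\<^esub> inv\<^bsub>?Q\<^esub> ?x (g \<otimes>\<^bsub>G\<^esub> h)"
      using x[of g] x[of h] x[of "g \<otimes>\<^bsub>G\<^esub> h"] c_closed[OF e] that
      by (subst Q.inv_solve_right) (auto simp only: G.m_closed Q.m_closed)
    also have "\<dots> = ?x h \<otimes>\<^bsub>?Q\<^esub> inv\<^bsub>?Q\<^esub> ?x (g \<otimes>\<^bsub>G\<^esub> h) \<otimes>\<^bsub>?Q\<^esub> ?x g"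
      using that by (simp only: Q.m_ac Q.m_closed Q.inv_closed x G.m_closed)
    also have "\<dots> = \<phi> (frag_of h \<otimes>\<^bsub>?F1\<^esub> inv\<^bsub>?F1\<^esub> frag_of (g \<otimes>\<^bsub>G\<^esub> h) \<otimes>\<^bsub>?F1\<^esub> frag_of g)"
    proof -
      have "frag_of k \<in> carrier ?F1" if "k \<in> carrier G" for k using that by simp
      then show ?thesis
        using that by (simp only: \<phi>.hom_mult \<phi>.hom_inv \<phi>_frag F1.m_closed F1.inv_closed G.m_closed)
    qed
    finally show ?thesis by (simp add: bar_boundary2_def)
  qed
  \<comment> \<open>Both sides are homomorphisms on 2-chains, so the agreement on generators
    extends; membership in the carrier is carried along for the homomorphism laws.\<close>
  have "u \<in> carrier ?F2 \<and> ?c (embed (q u)) = \<phi> (bar_boundary2 G u)"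
    if "Poly_Mapping.keys u \<subseteq> carrier G \<times> carrier G" for u
    using that
  proof (induction u rule: frag_induction)
    case zero
    show ?case using e.hom_one \<phi>.hom_one d2.hom_one by simp
  next
    case (one a)
    then obtain g h where a: "a = (g, h)" and gh: "g \<in> carrier G" "h \<in> carrier G" by auto
    have "frag_of (g, h) \<in> carrier ?F2" using gh by simp
    then show ?case unfolding a by (simp only: qf gen gh simp_thms)
  next
    case (diff a b)
    then have ab: "a \<in> carrier ?F2" "b \<in> carrier ?F2" by blast+
    then have "a \<otimes>\<^bsub>?F2\<^esub> inv\<^bsub>?F2\<^esub> b \<in> carrier ?F2" by (intro F2.m_closed F2.inv_closed)
    moreover have "?c (embed (q (a \<otimes>\<^bsub>?F2\<^esub> inv\<^bsub>?F2\<^esub> b)))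
        = \<phi> (bar_boundary2 G (a \<otimes>\<^bsub>?F2\<^esub> inv\<^bsub>?F2\<^esub> b))"
      using diff ab e.hom_mult[of a "inv\<^bsub>?F2\<^esub> b"] e.hom_inv[of b] by (simp only: d2.hom_mult d2.hom_inv d2.hom_closed
          \<phi>.hom_mult \<phi>.hom_inv F2.inv_closed F1.inv_closed)
    moreover have "a \<otimes>\<^bsub>?F2\<^esub> inv\<^bsub>?F2\<^esub> b = a - b" using ab by simp
    ultimately show ?case by simp
  qed
  moreover have "z \<in> carrier ?F2" "bar_boundary2 G z = \<one>\<^bsub>?F1\<^esub>"
    using z by (auto simp: bar_cycles2_def kernel_def)
  ultimately have "?c (embed (q z)) = \<one>\<^bsub>?Q\<^esub>" using \<phi>.hom_one by simp
  moreover have "embed (q z) \<in> carrier extension"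
    using hom_in_carrier[OF hom_embed] q.hom_closed \<open>z \<in> carrier ?F2\<close> by blast
  ultimately show ?thesis
    using E.rcos_self[OF _ D.subgroup_axioms] by (auto simp: FactGroup_def)
qed

text \<open>By \<open>bound\<close>, \<open>N\<close> kills the derived subgroup of the extension
  attached to chains modulo boundaries. This contains the classes of cycles, and
  \<open>embed\<close> is injective. A local hypothesis is monomorphic, so \<open>bound\<close> is
  fixed at the type of that extension.\<close>

lemma (in group) schur_multiplier_pow:
  fixes N :: nat
  assumes bound: "\<And>(H :: (('a \<times> 'a \<Rightarrow>\<^sub>0 int) set \<times> 'a) monoid) T x.
      \<lbrakk>crossed_pairing G H T; carrier H = crossed_pairing.span G H T (carrier G); x \<in> carrier H\<rbrakk>
      \<Longrightarrow> x [^]\<^bsub>H\<^esub> N = \<one>\<^bsub>H\<^esub>"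
    and A: "A \<in> carrier (schur_multiplier G)"
  shows "A [^]\<^bsub>schur_multiplier G\<^esub> N = \<one>\<^bsub>schur_multiplier G\<^esub>"
proof -
  let ?F2 = "free_Abelian_group (carrier G \<times> carrier G)"
  let ?F3 = "free_Abelian_group (carrier G \<times> carrier G \<times> carrier G)"
  let ?B = "bar_boundaries2 G"
  let ?M = "?F2 Mod ?B"
  let ?q = "\<lambda>u. ?B #>\<^bsub>?F2\<^esub> u"
  let ?Z = "?F2\<lparr>carrier := bar_cycles2 G\<rparr>"
  interpret F2: comm_group ?F2 by (rule abelian_free_Abelian_group)
  interpret d3: group_hom ?F3 ?F2 "bar_boundary3 G"
    by (simp add: group_hom_def group_hom_axioms_def bar_boundary3_hom)
  have B: "subgroup ?B ?F2" unfolding bar_boundaries2_def by (rule d3.img_is_subgroup)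
  interpret B: normal ?B ?F2 using F2.subgroup_imp_normal[OF B] .
  interpret M: comm_group ?M by (rule F2.abelian_FactGroup[OF B])
  have q: "?q \<in> hom ?F2 ?M" by (rule B.r_coset_hom_Mod)
  interpret q: group_hom ?F2 ?M ?q
    by (intro group_hom.intro group_hom_axioms.intro F2.group_axioms M.group_axioms q)
  have frag [simp]: "frag_of (g, h) \<in> carrier ?F2" if "g \<in> carrier G" "h \<in> carrier G" for g h
    using that by simp
  have q_B: "?q b = \<one>\<^bsub>?M\<^esub>" if "b \<in> ?B" for b
    using B.rcos_const that by (simp add: FactGroup_def)
  interpret cocycle ?M G "\<lambda>g h. ?q (frag_of (g, h))"
  proof unfold_locales
    show "?q (frag_of (g, h)) \<in> carrier ?M" if "g \<in> carrier G" "h \<in> carrier G" for g h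
      using that by (intro q.hom_closed frag)
    fix g h k assume ghk: "g \<in> carrier G" "h \<in> carrier G" "k \<in> carrier G"
    \<comment> \<open>The cocycle identity is the vanishing of this boundary in the
      quotient.\<close>
    let ?b = "bar_boundary3 G (frag_of (g, h, k))"
    have b: "?b \<in> ?B" unfolding bar_boundaries2_def using ghk by simp
    have "frag_of (h, k) \<otimes>\<^bsub>?F2\<^esub> frag_of (g, h \<otimes> k) = ?b \<otimes>\<^bsub>?F2\<^esub> (frag_of (g \<otimes> h, k) \<otimes>\<^bsub>?F2\<^esub> frag_of (g, h))"
      by (simp add: bar_boundary3_def)
    then have eq: "?q (frag_of (h, k) \<otimes>\<^bsub>?F2\<^esub> frag_of (g, h \<otimes> k))
        = ?q (?b \<otimes>\<^bsub>?F2\<^esub> (frag_of (g \<otimes> h, k) \<otimes>\<^bsub>?F2\<^esub> frag_of (g, h)))" by (rule arg_cong)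
    have fr: "frag_of (h, k) \<in> carrier ?F2" "frag_of (g, h \<otimes> k) \<in> carrier ?F2"
      "frag_of (g \<otimes> h, k) \<in> carrier ?F2" "frag_of (g, h) \<in> carrier ?F2"
      using ghk by simp_all
    show "?q (frag_of (h, k)) \<otimes>\<^bsub>?M\<^esub> ?q (frag_of (g, h \<otimes> k))
        = ?q (frag_of (g \<otimes> h, k)) \<otimes>\<^bsub>?M\<^esub> ?q (frag_of (g, h))"
      using eq unfolding q.hom_mult[OF fr(1,2)] q.hom_mult[OF fr(3,4)] q_B[OF b]
        q.hom_mult[OF B.mem_carrier[OF b] F2.m_closed[OF fr(3,4)]]
        M.l_one[OF M.m_closed[OF q.hom_closed[OF fr(3)] q.hom_closed[OF fr(4)]]] .
  qed
  interpret E: group extension by (rule group_extension)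
  let ?D = "derived extension (carrier extension)"
  have s: "(\<one>\<^bsub>?M\<^esub>, g) \<in> carrier extension" "snd (\<one>\<^bsub>?M\<^esub>, g) = g" if "g \<in> carrier G" for g
    using that by (simp_all add: M.one_closed del: one_FactGroup carrier_FactGroup)
  note cp = central_extension_crossed_pairing[OF group_extension group_axioms hom_snd_extension
      central_extension s]
  have D_pow: "x [^]\<^bsub>extension\<^esub> N = \<one>\<^bsub>extension\<^esub>" if "x \<in> ?D" for x
  proof -
    have "x [^]\<^bsub>extension\<lparr>carrier := ?D\<rparr>\<^esub> N = \<one>\<^bsub>extension\<lparr>carrier := ?D\<rparr>\<^esub>"
    proof (rule bound[OF cp])
      show "x \<in> carrier (extension\<lparr>carrier := ?D\<rparr>)"
        using that by (simp del: carrier_extension)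
    qed
    then show ?thesis by (simp add: E.nat_pow_consistent [symmetric])
  qed
  interpret e: group_hom ?M extension embed
    using hom_embed by (simp add: group_hom_def group_hom_axioms_def E.group_axioms M.group_axioms)
  have key: "z [^]\<^bsub>?F2\<^esub> N \<in> ?B" if z: "z \<in> bar_cycles2 G" for z
  proof -
    have zF: "z \<in> carrier ?F2" using z by (simp add: bar_cycles2_def kernel_def)
    have "embed (?q z) [^]\<^bsub>extension\<^esub> N = \<one>\<^bsub>extension\<^esub>"
      by (intro D_pow embed_cycle_in_derived[OF q _ z]) simp
    then have "embed (?q (z [^]\<^bsub>?F2\<^esub> N)) = \<one>\<^bsub>extension\<^esub>"
      by (simp only: e.hom_nat_pow q.hom_nat_pow zF q.hom_closed)
    then have "?q (z [^]\<^bsub>?F2\<^esub> N) = \<one>\<^bsub>?M\<^esub>"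
      using zF q.hom_closed F2.nat_pow_closed by (intro embed_eq_one) blast+
    then show ?thesis
      using F2.rcos_self[OF _ B, of "z [^]\<^bsub>?F2\<^esub> N"] zF F2.nat_pow_closed by (simp add: FactGroup_def)
  qed
  \<comment> \<open>What remains is to pass from cosets in all 2-chains to cosets in the cycles, of
    which the multiplier consists.\<close>
  interpret d2: group_hom ?F2 "free_Abelian_group (carrier G)" "bar_boundary2 G"
    by (simp add: group_hom_def group_hom_axioms_def bar_boundary2_hom)
  have Z: "subgroup (bar_cycles2 G) ?F2"
    unfolding bar_cycles2_def by (rule d2.subgroup_kernel)
  have BZ: "?B \<subseteq> bar_cycles2 G"
  proof
    fix z assume "z \<in> ?B"
    then obtain c where "c \<in> carrier ?F3" "z = bar_boundary3 G c"
      unfolding bar_boundaries2_def by blast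
    then show "z \<in> bar_cycles2 G"
      using d3.hom_closed bar_boundary2_boundary3 by (simp add: bar_cycles2_def kernel_def)
  qed
  interpret Z: comm_group ?Z
    by (rule group.group_comm_groupI[OF F2.subgroup_imp_group[OF Z]]) (simp add: add.commute)
  interpret ZB: normal ?B ?Z
    using Z.subgroup_imp_normal[OF F2.subgroup_incl[OF B Z BZ]] .
  obtain z where z: "z \<in> carrier ?Z" and Az: "A = ?B #>\<^bsub>?Z\<^esub> z"
    using A unfolding schur_multiplier_def FactGroup_def RCOSETS_def by auto
  interpret qZ: group_hom ?Z "?Z Mod ?B" "\<lambda>u. ?B #>\<^bsub>?Z\<^esub> u"
    using ZB.r_coset_hom_Mod ZB.factorgroup_is_group
    by (simp add: group_hom_def group_hom_axioms_def Z.group_axioms)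
  have "A [^]\<^bsub>?Z Mod ?B\<^esub> N = ?B #>\<^bsub>?Z\<^esub> (z [^]\<^bsub>?Z\<^esub> N)"
    unfolding Az using qZ.hom_nat_pow[OF z] by simp
  also have "\<dots> = ?B"
  proof (rule ZB.rcos_const)
    have "z \<in> bar_cycles2 G" using z by simp
    then show "z [^]\<^bsub>?Z\<^esub> N \<in> ?B"
      using key[OF \<open>z \<in> bar_cycles2 G\<close>] F2.nat_pow_consistent[of z N "bar_cycles2 G"] by (simp only:)
  qed (rule Z.group_axioms)
  finally show ?thesis by (simp add: schur_multiplier_def FactGroup_def)
qed

section \<open>Bounds for the tensor square and the Schur multiplier\<close>

theorem theorem7p3:
  fixes G :: "('a, 'b) monoid_scheme" and d :: nat
  assumes "group G" and "solvable G" and "derived_length G = d"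
  shows "(odd (group_exponent G) \<longrightarrow>
            group_exponent (tensor_square G) dvd group_exponent G ^ d \<and>
            group_exponent (schur_multiplier G) dvd group_exponent G ^ d) \<and>
         (group_exponent G > 0 \<and> even (group_exponent G) \<longrightarrow>
            group_exponent (tensor_square G) dvd 2 ^ (d - 1) * group_exponent G ^ d \<and>
            group_exponent (schur_multiplier G) dvd 2 ^ (d - 1) * group_exponent G ^ d)"
proof -
  interpret group G by fact
  interpret T: group "tensor_square G" by (rule group_tensor_square)
  interpret S: comm_group "schur_multiplier G" by (rule comm_group_schur_multiplier)
  let ?n = "group_exponent G"
  have d: "(derived G ^^ d) (carrier G) = {\<one>\<^bsub>G\<^esub>}"
    using assms(2,3) solvable_iff_trivial_derived_seq
      LeastI_ex[of "\<lambda>n. (derived G ^^ n) (carrier G) = {\<one>\<^bsub>G\<^esub>}"]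
    by (simp add: derived_length_def)
  have bounds: "group_exponent (tensor_square G) dvd N \<and> group_exponent (schur_multiplier G) dvd N"
    if "?n > 0" and N: "odd ?n \<and> N = ?n ^ d \<or> N = 2 ^ (d - 1) * ?n ^ d" for N
  proof -
    have "N > 0" using that by auto
    note exp = pow_group_exponent[OF \<open>?n > 0\<close>]
    have tensor: "x [^]\<^bsub>tensor_square G\<^esub> N = \<one>\<^bsub>tensor_square G\<^esub>" if "x \<in> carrier (tensor_square G)" for x
      using crossed_pairing.exponent_bound[OF crossed_pairing_tensor carrier_tensor_square exp d that] N by auto
    have schur: "A [^]\<^bsub>schur_multiplier G\<^esub> N = \<one>\<^bsub>schur_multiplier G\<^esub>" if "A \<in> carrier (schur_multiplier G)" for A
    proof (rule schur_multiplier_pow[OF _ that])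
      fix H :: "(('a \<times> 'a \<Rightarrow>\<^sub>0 int) set \<times> 'a) monoid" and T x
      assume "crossed_pairing G H T" "carrier H = crossed_pairing.span G H T (carrier G)" "x \<in> carrier H"
      from crossed_pairing.exponent_bound[OF this(1,2) exp d this(3)]
      show "x [^]\<^bsub>H\<^esub> N = \<one>\<^bsub>H\<^esub>" using N by auto
    qed
    show ?thesis
      using T.group_exponent_dvd S.group_exponent_dvd \<open>N > 0\<close> tensor schur by blast
  qed
  \<comment> \<open>An infinite exponent is coded by 0, which is even; so an odd exponent is
    positive.\<close>
  show ?thesis using bounds by (auto simp: odd_pos)
qed

end
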